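(* Let $1\leq p_0,p_1<\infty$, and let $W_0,W_1:\mathbb{R}^n\to\mathcal{S}_d$ be measurable matrix mappings, positive definite almost everywhere, such that $W_0\in\mathcal{A}_{p_0,matrix}$, $W_1\in\mathcal{A}_{p_1,matrix}$, and the functions $x\mapsto\sup_{|v|=1}|W_0(x)v|$ and $x\mapsto\sup_{|v|=1}|W_1(x)v|$ are bounded on $\mathbb{R}^n$. Then for any $0<t<1$, $\overline{W}=(W_0^2\#_tW_1^2)^{1/2}\in\mathcal{A}_{p,matrix}$, where $$\frac1p=\frac{1-t}{p_0}+\frac{t}{p_1}.$$
   Context: $\mathcal{S}_d$ is the set of $d\times d$ real symmetric positive semidefinite matrices. A matrix mapping is measurable if each of its components is a measurable function. $|v|$ is the Euclidean norm, $\lVert U\rVert_{\mathrm{op}}$ the operator norm of a matrix $U$, $m_n$ Lebesgue measure on $\mathbb{R}^n$, and $p'$ the conjugate exponent of $p$; suprema over $Q$ are over all cubes $Q\subset\mathbb{R}^n$ with sides parallel to the coordinate axes. For $1<p<\infty$, $W\in\mathcal{A}_{p,matrix}$ means $$[W]_{\mathcal{A}_{p,matrix}}=\sup_{Q}\left(\frac{1}{m_n(Q)}\int_Q\left(\frac{1}{m_n(Q)}\int_Q\lVert W(x)W^{-1}(y)\rVert_{\mathrm{op}}^{p'}dy\right)^{\frac{p}{p'}}dx\right)^{\frac1p}<\infty,$$ and for $p=1$, $W\in\mathcal{A}_{1,matrix}$ means $$[W]_{\mathcal{A}_{1,matrix}}=\sup_Q\operatorname*{ess\,sup}_{x\in Q}\frac{1}{m_n(Q)}\int_Q\lVert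 W^{-1}(x)W(y)\rVert_{\mathrm{op}}\,dy<\infty.$$ For symmetric positive definite matrices $A,B$ and $0<t<1$, the weighted geometric mean is $A\#_tB=A^{1/2}(A^{-1/2}BA^{-1/2})^tA^{1/2}$; for matrix mappings it is taken pointwise (a.e.). *)

theory Defs
  imports "HOL-Analysis.Analysis" "HOL-Probability.Essential_Supremum"
begin

definition psd_mats :: "(real^'d^'d) set" where
  "psd_mats = {A. transpose A = A \<and> (\<forall>v. 0 \<le> v \<bullet> (A *v v))}"

definition positive_definite :: "real^'d^'d \<Rightarrow> bool" where
  "positive_definite A \<longleftrightarrow> transpose A = A \<and> (\<forall>v. v \<noteq> 0 \<longrightarrow> 0 < v \<bullet> (A *v v))"

definition diag_mat :: "('d \<Rightarrow> real) \<Rightarrow> real^'d^'d" where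
  "diag_mat l = (\<chi> i j. if i = j then l i else 0)"

text \<open>
  Real powers of a symmetric positive semidefinite matrix by functional calculus: diagonalise
  orthogonally and apply the power to the eigenvalues. The value does not depend on the chosen
  diagonalisation, see \<open>mat_powr_diagonalised\<close> below. Since \<open>0 powr s = 0\<close> for every \<open>s\<close>, a negative
  power is an inverse only for positive definite matrices; on singular ones it is still positive
  semidefinite, but it has no mathematical meaning here.
\<close>
definition mat_powr :: "real^'d^'d \<Rightarrow> real \<Rightarrow> real^'d^'d" where
  "mat_powr A s = (THE B. \<exists>P l. orthogonal_matrix P \<and>
      A = P ** diag_mat l ** transpose P \<and>
      B = P ** diag_mat (\<lambda>i. l i powr s) ** transpose P)"

lemma mat_mult_diag_mat: "(A ** diag_mat l) $ i $ j = A $ i $ j * l j"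
  by (simp add: matrix_matrix_mult_def diag_mat_def if_distrib[of "\<lambda>x. _ * x"] cong: if_cong)

lemma diag_mat_mult_mat: "(diag_mat l ** A) $ i $ j = l i * A $ i $ j"
  by (simp add: matrix_matrix_mult_def diag_mat_def if_distrib[of "\<lambda>x. x * _"] cong: if_cong)

lemma diagonalised_unique:
  fixes P Q :: "real^'d^'d"
  assumes P: "orthogonal_matrix P" and Q: "orthogonal_matrix Q"
    and eq: "P ** diag_mat l ** transpose P = Q ** diag_mat m ** transpose Q"
  shows "P ** diag_mat (\<lambda>i. f (l i)) ** transpose P = Q ** diag_mat (\<lambda>i. f (m i)) ** transpose Q"
proof -
  define R where "R = transpose Q ** P"
  have PP: "transpose P ** P = mat 1" "P ** transpose P = mat 1"
    and QQ: "transpose Q ** Q = mat 1" "Q ** transpose Q = mat 1"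
    using P Q by (auto simp: orthogonal_matrix_def)
  have "R ** diag_mat l = transpose Q ** (P ** diag_mat l ** transpose P) ** P"
    unfolding R_def by (metis PP(1) matrix_mul_assoc matrix_mul_rid)
  also have "\<dots> = diag_mat m ** R"
    unfolding R_def eq by (metis QQ(1) matrix_mul_assoc matrix_mul_lid)
  finally have "R $ i $ j * l j = m i * R $ i $ j" for i j
    by (metis mat_mult_diag_mat diag_mat_mult_mat)
  then have "R $ i $ j * f (l j) = f (m i) * R $ i $ j" for i j
    by (metis mult.commute mult_cancel_left)
  then have comm: "R ** diag_mat (\<lambda>i. f (l i)) = diag_mat (\<lambda>i. f (m i)) ** R"
    by (simp add: vec_eq_iff mat_mult_diag_mat diag_mat_mult_mat)
  have QR: "Q ** R = P" and RP: "R ** transpose P = transpose Q"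
    unfolding R_def by (metis QQ(2) matrix_mul_assoc matrix_mul_lid,
      metis PP(2) matrix_mul_assoc matrix_mul_rid)
  have "P ** diag_mat (\<lambda>i. f (l i)) ** transpose P
      = Q ** (R ** diag_mat (\<lambda>i. f (l i))) ** transpose P"
    by (metis QR matrix_mul_assoc)
  also have "\<dots> = Q ** diag_mat (\<lambda>i. f (m i)) ** (R ** transpose P)"
    unfolding comm by (simp add: matrix_mul_assoc)
  finally show ?thesis unfolding RP .
qed

lemma mat_powr_diagonalised:
  assumes "orthogonal_matrix P"
  shows "mat_powr (P ** diag_mat l ** transpose P) s
       = P ** diag_mat (\<lambda>i. l i powr s) ** transpose P"
  unfolding mat_powr_def
proof (rule the_equality, goal_cases)
  case 1
  show ?case using assms by blast
next
  case (2 B)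
  then show ?case using diagonalised_unique[OF assms, where f = "\<lambda>x. x powr s"] by metis
qed

definition geo_mean :: "real \<Rightarrow> real^'d^'d \<Rightarrow> real^'d^'d \<Rightarrow> real^'d^'d" where
  "geo_mean t A B =
    mat_powr A (1/2) ** mat_powr (mat_powr A (-1/2) ** B ** mat_powr A (-1/2)) t ** mat_powr A (1/2)"

abbreviation op_norm :: "real^'d^'d \<Rightarrow> real" where
  "op_norm A \<equiv> onorm ((*v) A)"

text \<open>
  Measurability is Lebesgue measurability, so that a mapping may be changed freely on null sets.
\<close>
definition matrix_weight :: "(real^'n \<Rightarrow> real^'d^'d) \<Rightarrow> bool" where
  "matrix_weight W \<longleftrightarrow>
     (\<forall>x. W x \<in> psd_mats) \<and>
     (\<forall>i j. (\<lambda>x. W x $ i $ j) \<in> borel_measurable lebesgue) \<and>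
     (AE x in lebesgue. positive_definite (W x))"

definition cubes :: "(real^'n) set set" where
  "cubes = {cbox a (a + (\<chi> i. s)) | a s. 0 < s}"

definition average :: "(real^'n) set \<Rightarrow> (real^'n \<Rightarrow> ennreal) \<Rightarrow> ennreal" where
  "average Q f = (\<integral>\<^sup>+y\<in>Q. f y \<partial>lebesgue) / emeasure lebesgue Q"

text \<open>Used for exponents \<open>a > 0\<close> only.\<close>
definition ennreal_powr :: "ennreal \<Rightarrow> real \<Rightarrow> ennreal" where
  "ennreal_powr x a = (if x = \<infinity> then \<infinity> else ennreal (enn2real x powr a))"

definition conj_exp :: "real \<Rightarrow> real" where
  "conj_exp p = p / (p - 1)"

definition Ap_const :: "real \<Rightarrow> (real^'n \<Rightarrow> real^'d^'d) \<Rightarrow> ennreal" where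
  "Ap_const p W = (SUP Q\<in>cubes.
     ennreal_powr
       (average Q (\<lambda>x.
          ennreal_powr
            (average Q (\<lambda>y. ennreal (op_norm (W x ** matrix_inv (W y)) powr conj_exp p)))
            (p / conj_exp p)))
       (1 / p))"

definition A1_const :: "(real^'n \<Rightarrow> real^'d^'d) \<Rightarrow> ennreal" where
  "A1_const W = (SUP Q\<in>cubes.
     esssup (restrict_space lebesgue Q)
       (\<lambda>x. average Q (\<lambda>y. ennreal (op_norm (matrix_inv (W x) ** W y)))))"

definition A_matrix :: "real \<Rightarrow> (real^'n \<Rightarrow> real^'d^'d) set" where
  "A_matrix p = {W. matrix_weight W \<and> (if p = 1 then A1_const W else Ap_const p W) < \<infinity>}"

end

theory Submission
  imports Defs "HOL-Probability.Probability_Measure"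
begin

text \<open>
  Simultaneous diagonalisation turns the geometric mean into a weighted mean of eigenvalues, and a
  midpoint-convexity argument for operator norms (an elementary form of the three lines theorem)
  gives, with \<open>V = (W\<^sub>0\<^sup>2 #\<^sub>t W\<^sub>1\<^sup>2)\<^sup>1\<^sup>/\<^sup>2\<close>, the pointwise bound
  \<open>\<parallel>V(x) V(y)\<^sup>-\<^sup>1\<parallel> \<le> \<parallel>W\<^sub>0(x) W\<^sub>0(y)\<^sup>-\<^sup>1\<parallel>\<^sup>1\<^sup>-\<^sup>t \<parallel>W\<^sub>1(x) W\<^sub>1(y)\<^sup>-\<^sup>1\<parallel>\<^sup>t\<close>. Hoelder's inequality in \<open>y\<close> and then in \<open>x\<close>
  finishes the proof when both exponents exceed 1. If exactly one of them is 1, the essential supremum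
  in its \<open>A\<^sub>1\<close> condition stands outside the average instead of inside; an Auerbach basis of the norm
  \<open>v \<mapsto> avg\<^sub>Q |W(x) v|\<close> factors the kernel and allows the two to be exchanged at the cost of a
  dimensional constant.
\<close>

section \<open>Spectral theorem\<close>

text \<open>The diagonalisations at \<open>x\<close> and at \<open>y\<close> use unrelated
  coordinate systems, so the weighted sums of squares cannot be compared term by term. What can be
  interpolated is the operator norm of the transition matrix with powers of the eigenvalues on both
  sides. The exponents fit because the conjugate exponents obey the same relation,
  \<open>1 / q = (1 - t) / q\<^sub>0 + t / q\<^sub>1\<close>. At an endpoint exponent 1 the inner
  step needs a majorant \<open>H x\<close> of the kernel that is independent of \<open>y\<close> and
  whose average is bounded uniformly over cubes, whereas the A_1 condition bounds, for almost every
  \<open>y\<close>, an average over \<open>x\<close>. The price of the exchange is the square of the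
  dimension d: one factor d from the averages of the d column norms, one from the d coordinates in
  the Auerbach basis. Boundedness of the weights makes the averaged norm finite. If both exponents
  are 1, so is \<open>p\<close>; the essential supremum then stays outside on both sides, and one
  application of Hoelder's inequality in \<open>x\<close> suffices.\<close>

lemma symmetric_inner_commute:
  fixes A :: "real^'n^'n"
  assumes "transpose A = A"
  shows "x \<bullet> (A *v y) = (A *v x) \<bullet> y"
  by (metis assms dot_lmul_matrix transpose_matrix_vector)

text \<open>A maximiser of the Rayleigh quotient is an eigenvector: if the residual
  \<open>A *v v - \<mu> *\<^sub>R v\<close> were nonzero, moving along it would raise the quotient
  to first order. The maximality clause is kept in the conclusion because it later bounds an
  operator norm by the eigenvalue.\<close>

lemma symmetric_rayleigh_max:
  fixes A :: "real^'n^'n"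
  assumes sym: "transpose A = A" and S: "subspace S"
    and inv: "\<And>x. x \<in> S \<Longrightarrow> A *v x \<in> S" and x0: "x0 \<in> S" "x0 \<noteq> 0"
  obtains v \<mu> where "v \<in> S" "norm v = 1" "A *v v = \<mu> *\<^sub>R v"
    "\<And>u. u \<in> S \<Longrightarrow> u \<bullet> (A *v u) \<le> \<mu> * (norm u)\<^sup>2"
proof -
  define f where "f u = u \<bullet> (A *v u)" for u
  define K where "K = S \<inter> sphere 0 1"
  have K: "compact K"
    unfolding K_def by (intro closed_Int_compact closed_subspace S compact_sphere)
  have "x0 /\<^sub>R norm x0 \<in> K"
    unfolding K_def using x0 S by (auto simp: subspace_scale)
  then have K0: "K \<noteq> {}" by blast
  have "continuous_on K f"
    unfolding f_def by (intro continuous_intros linear_continuous_on matrix_vector_mul_bounded_linear)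
  then obtain v where v: "v \<in> K" and vmax: "\<And>u. u \<in> K \<Longrightarrow> f u \<le> f v"
    using continuous_attains_sup[OF K K0] by blast
  define \<mu> where "\<mu> = f v"
  have vS: "v \<in> S" and v1: "norm v = 1" using v by (auto simp: K_def)
  have max: "f u \<le> \<mu> * (norm u)\<^sup>2" if "u \<in> S" for u
  proof (cases "u = 0")
    case False
    then have "u /\<^sub>R norm u \<in> K" using that S by (auto simp: K_def subspace_scale)
    from vmax[OF this] have "f (u /\<^sub>R norm u) \<le> \<mu>" by (simp add: \<mu>_def)
    moreover have "f (u /\<^sub>R norm u) = f u / (norm u)\<^sup>2"
      by (simp add: f_def matrix_vector_mult_scaleR power2_eq_square divide_inverse mult.commute mult.left_commute)
    ultimately have "f u / (norm u)\<^sup>2 \<le> \<mu>" by simp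
    then show ?thesis using False by (simp add: pos_divide_le_eq)
  qed (simp add: f_def)
  define w where "w = A *v v - \<mu> *\<^sub>R v"
  have wS: "w \<in> S" unfolding w_def by (intro subspace_diff subspace_scale S inv vS)
  define c where "c = \<mu> * (norm w)\<^sup>2 - f w"
  \<comment> \<open>Maximality at \<open>v + s *\<^sub>R w\<close>: the terms with
    \<open>w \<bullet> v\<close> cancel, and what remains is linear in \<open>s\<close> on the left
    and quadratic on the right.\<close>
  have ineq: "2 * s * (norm w)\<^sup>2 \<le> s\<^sup>2 * c" for s
  proof -
    have "v + s *\<^sub>R w \<in> S" by (intro subspace_add subspace_scale S vS wS)
    note max[OF this]
    moreover have "f (v + s *\<^sub>R w) = \<mu> + 2 * s * (w \<bullet> (A *v v)) + s\<^sup>2 * f w"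
      unfolding f_def \<mu>_def using symmetric_inner_commute[OF sym, of v w]
      by (simp add: f_def matrix_vector_right_distrib matrix_vector_mult_scaleR inner_add_left inner_add_right
          power2_eq_square algebra_simps inner_commute)
    moreover have "(norm (v + s *\<^sub>R w))\<^sup>2 = 1 + 2 * s * (w \<bullet> v) + s\<^sup>2 * (norm w)\<^sup>2"
    proof -
      have "v \<bullet> v = 1" using v1 by (simp add: norm_eq_1)
      then show ?thesis unfolding power2_norm_eq_inner
        by (simp add: inner_add_left inner_add_right power2_eq_square algebra_simps inner_commute)
    qed
    moreover have "w \<bullet> (A *v v) = (norm w)\<^sup>2 + \<mu> * (w \<bullet> v)"
      unfolding power2_norm_eq_inner by (simp add: w_def inner_diff_right)
    ultimately show ?thesis by (simp add: c_def algebra_simps)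
  qed
  have "w = 0"
  proof (rule ccontr)
    assume "w \<noteq> 0"
    \<comment> \<open>Small enough that \<open>s * c\<close> is at most the squared norm of
      \<open>w\<close>, although the inequality demands at least twice that; the summand 1 keeps the
      denominator positive.\<close>
    define s where "s = (norm w)\<^sup>2 / (\<bar>c\<bar> + 1)"
    have s: "0 < s" using \<open>w \<noteq> 0\<close> by (simp add: s_def)
    have "s * (2 * (norm w)\<^sup>2) \<le> s * (s * c)"
      using ineq[of s] by (simp add: power2_eq_square algebra_simps)
    then have "2 * (norm w)\<^sup>2 \<le> s * c" using s by simp
    also have "\<dots> \<le> s * (\<bar>c\<bar> + 1)" using s by simp
    also have "\<dots> = (norm w)\<^sup>2" by (simp add: s_def)
    finally show False using \<open>w \<noteq> 0\<close> by simp
  qed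
  then have "A *v v = \<mu> *\<^sub>R v" by (simp add: w_def)
  with vS v1 max show ?thesis by (intro that) (auto simp: f_def)
qed

text \<open>An orthonormal set of eigenvectors of greatest cardinality spans the space: its
  orthogonal complement is invariant under \<open>A\<close> by symmetry, so a nonzero complement
  would contain one more unit eigenvector.\<close>

theorem symmetric_orthogonally_diagonalisable:
  fixes A :: "real^'n^'n"
  assumes sym: "transpose A = A"
  obtains P l where "orthogonal_matrix P" "A = P ** diag_mat l ** transpose P"
proof -
  define E where "E B \<longleftrightarrow> pairwise orthogonal B \<and> (\<forall>b\<in>B. norm b = 1 \<and> (\<exists>\<mu>. A *v b = \<mu> *\<^sub>R b))"
    for B :: "(real^'n) set"
  have indep: "independent B" if "E B" for B
    using that by (intro pairwise_orthogonal_independent) (auto simp: E_def)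
  have bound: "card B \<le> CARD('n)" if "E B" for B
    using independent_bound[OF indep[OF that]] by simp
  have "E {}" by (simp add: E_def)
  then obtain B where B: "E B" and Bmax: "\<And>B'. E B' \<Longrightarrow> card B' \<le> card B"
    using ex_has_greatest_nat[of E "{}" card "CARD('n) + 1"] bound by (metis le_imp_less_Suc Suc_eq_plus1)
  have finB: "finite B" using independent_bound[OF indep[OF B]] by simp
  have "span B = UNIV"
  proof (rule ccontr)
    assume "span B \<noteq> UNIV"
    then obtain x0 where x0: "x0 \<noteq> 0" "\<forall>x\<in>span B. x0 \<bullet> x = 0"
      using span_not_UNIV_orthogonal by blast
    define S where "S = {x. \<forall>b\<in>B. b \<bullet> x = 0}"
    have S: "subspace S" by (auto simp: S_def subspace_def inner_add_right)
    have inv: "A *v x \<in> S" if "x \<in> S" for x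
      unfolding S_def
    proof clarify
      fix b assume b: "b \<in> B"
      then obtain \<mu> where "A *v b = \<mu> *\<^sub>R b" using B by (auto simp: E_def)
      then show "b \<bullet> (A *v x) = 0"
        using that b by (simp add: symmetric_inner_commute[OF sym] S_def)
    qed
    have "x0 \<in> S" using x0 by (auto simp: S_def span_base inner_commute)
    from symmetric_rayleigh_max[OF sym S inv this x0(1)]
    obtain v \<mu> where v: "v \<in> S" "norm v = 1" "A *v v = \<mu> *\<^sub>R v" by blast
    have "v \<notin> B" using v by (auto simp: S_def)
    moreover have "E (insert v B)"
      using B v by (auto simp: E_def pairwise_insert S_def orthogonal_def inner_commute)
    ultimately show False using Bmax[of "insert v B"] finB by simp
  qed
  then have "card B = CARD('n)"
    using dim_span_eq_card_independent[OF indep[OF B]] by simp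
  then obtain h where h: "bij_betw h (UNIV :: 'n set) B"
    using finB by (metis finite bij_betw_iff_card)
  define P where "P = (\<chi> i j. h j $ i)"
  have col: "column j P = h j" for j by (simp add: column_def P_def vec_eq_iff)
  have hB: "h j \<in> B" for j using h by (auto simp: bij_betw_def)
  have hinj: "h i = h j \<longleftrightarrow> i = j" for i j using h by (auto simp: bij_betw_def inj_on_def)
  have P: "orthogonal_matrix P"
    unfolding orthogonal_matrix_orthonormal_columns col
    using B hB by (auto simp: E_def pairwise_def hinj)
  have "\<exists>l. \<forall>j. A *v h j = l j *\<^sub>R h j"
    using B hB by (auto simp: E_def intro: choice)
  then obtain l where l: "\<And>j. A *v h j = l j *\<^sub>R h j" by blast
  have "(A ** P) $ i $ j = (P ** diag_mat l) $ i $ j" for i j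
    unfolding mat_mult_diag_mat using arg_cong[OF l[of j], of "\<lambda>x. x $ i"]
    by (simp add: P_def matrix_matrix_mult_def matrix_vector_mult_def mult.commute)
  then have "A ** P = P ** diag_mat l" by (simp add: vec_eq_iff)
  then have "A ** (P ** transpose P) = P ** diag_mat l ** transpose P"
    by (simp add: matrix_mul_assoc)
  then have "A = P ** diag_mat l ** transpose P"
    using P by (simp add: orthogonal_matrix_def)
  with P show ?thesis by (rule that)
qed

section \<open>Powers and geometric means of positive definite matrices\<close>

lemma diag_mat_mult: "diag_mat l ** diag_mat m = diag_mat (\<lambda>i. l i * m i)"
  by (simp add: vec_eq_iff diag_mat_mult_mat) (simp add: diag_mat_def)

lemma diag_mat_one: "diag_mat (\<lambda>i. 1) = mat 1"
  by (simp add: diag_mat_def mat_def)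

lemma transpose_diag_mat: "transpose (diag_mat l) = diag_mat l"
  by (simp add: diag_mat_def transpose_def vec_eq_iff)

lemma diag_mat_vector: "(diag_mat l *v x) $ i = l i * x $ i"
  by (simp add: diag_mat_def matrix_vector_mult_def if_distrib[of "\<lambda>a. a * _"] cong: if_cong)

lemma quadratic_form_diag:
  fixes S :: "real^'n^'n"
  shows "x \<bullet> ((transpose S ** diag_mat l ** S) *v x) = (\<Sum>i\<in>UNIV. l i * ((S *v x) $ i)\<^sup>2)"
proof -
  have "x \<bullet> ((transpose S ** diag_mat l ** S) *v x) = (S *v x) \<bullet> (diag_mat l *v (S *v x))"
    by (metis dot_lmul_matrix matrix_vector_mul_assoc transpose_matrix_vector transpose_transpose)
  then show ?thesis
    by (simp add: inner_vec_def diag_mat_vector power2_eq_square mult.commute mult.left_commute)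
qed

lemma orthogonal_conj_mult:
  assumes "orthogonal_matrix P"
  shows "(P ** diag_mat l ** transpose P) ** (P ** diag_mat m ** transpose P)
       = P ** diag_mat (\<lambda>i. l i * m i) ** transpose P"
proof -
  have "(P ** diag_mat l ** transpose P) ** (P ** diag_mat m ** transpose P)
      = P ** diag_mat l ** (transpose P ** P) ** diag_mat m ** transpose P"
    by (simp add: matrix_mul_assoc)
  also have "\<dots> = P ** (diag_mat l ** diag_mat m) ** transpose P"
    using assms by (simp add: orthogonal_matrix_def matrix_mul_assoc)
  finally show ?thesis by (simp add: diag_mat_mult)
qed

lemma transpose_conj_diag: "transpose (P ** diag_mat l ** transpose P) = P ** diag_mat l ** transpose P"
  by (simp add: matrix_transpose_mul transpose_diag_mat matrix_mul_assoc)

lemma conj_diag_psd: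
  fixes P :: "real^'n^'n"
  assumes "\<And>i. 0 \<le> l i"
  shows "P ** diag_mat l ** transpose P \<in> psd_mats"
proof -
  have "0 \<le> v \<bullet> ((P ** diag_mat l ** transpose P) *v v)" for v
    using quadratic_form_diag[of v "transpose P" l] assms by (simp add: sum_nonneg)
  then show ?thesis by (simp add: psd_mats_def transpose_conj_diag)
qed

text \<open>\<open>powr\<close> never takes a negative value, so symmetry alone suffices. This
  matters on the null set where a weight may be singular, since \<open>matrix_weight\<close> demands
  semidefiniteness at every point.\<close>

lemma mat_powr_psd:
  assumes "transpose A = A"
  shows "mat_powr A s \<in> psd_mats"
proof -
  obtain P l where P: "orthogonal_matrix P" "A = P ** diag_mat l ** transpose P"
    using symmetric_orthogonally_diagonalisable[OF assms] by blast
  show ?thesis unfolding P(2) mat_powr_diagonalised[OF P(1)]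
    by (rule conj_diag_psd) simp
qed

lemma positive_definite_diagonalisable:
  fixes A :: "real^'n^'n"
  assumes "positive_definite A"
  obtains P l where "orthogonal_matrix P" "A = P ** diag_mat l ** transpose P" "\<And>i. 0 < l i"
proof -
  obtain P l where P: "orthogonal_matrix P" "A = P ** diag_mat l ** transpose P"
    using symmetric_orthogonally_diagonalisable assms unfolding positive_definite_def by blast
  have "0 < l k" for k
  proof -
    define v where "v = P *v axis k 1"
    have Pv: "transpose P *v v = axis k 1"
      using P(1) by (metis v_def matrix_vector_mul_assoc matrix_vector_mul_lid orthogonal_matrix_def)
    then have "v \<noteq> 0" by (metis axis_eq_0_iff matrix_vector_mult_0_right zero_neq_one)
    then have "0 < v \<bullet> (A *v v)" using assms by (auto simp: positive_definite_def)
    also have "\<dots> = (\<Sum>i\<in>UNIV. l i * ((transpose P *v v) $ i)\<^sup>2)"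
      using quadratic_form_diag[of v "transpose P" l] by (simp add: P(2))
    also have "\<dots> = l k" unfolding Pv
      by (simp add: axis_def if_distrib[of "\<lambda>a. _ * a\<^sup>2"] if_distrib[of "\<lambda>a. _ * a"] cong: if_cong)
    finally show ?thesis .
  qed
  with P show ?thesis by (rule that)
qed

lemma mat_powr_add:
  assumes "positive_definite A"
  shows "mat_powr A s ** mat_powr A u = mat_powr A (s + u)"
proof -
  obtain P l where P: "orthogonal_matrix P" "A = P ** diag_mat l ** transpose P" "\<And>i. 0 < l i"
    using positive_definite_diagonalisable[OF assms] by blast
  show ?thesis unfolding P(2) mat_powr_diagonalised[OF P(1)] orthogonal_conj_mult[OF P(1)]
    by (simp add: powr_add)
qed

lemma mat_powr_one:
  assumes "positive_definite A"
  shows "mat_powr A 1 = A"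
proof -
  obtain P l where P: "orthogonal_matrix P" "A = P ** diag_mat l ** transpose P" "\<And>i. 0 < l i"
    using positive_definite_diagonalisable[OF assms] by blast
  show ?thesis unfolding P(2) mat_powr_diagonalised[OF P(1)] using P(3) by (simp add: less_imp_le)
qed

text \<open>As \<open>0 powr 0 = 0\<close>, the zeroth power of a singular symmetric matrix is the
  projection onto its range; positive definiteness turns it into the identity.\<close>

lemma mat_powr_zero:
  assumes "positive_definite A"
  shows "mat_powr A 0 = mat 1"
proof -
  obtain P l where P: "orthogonal_matrix P" "A = P ** diag_mat l ** transpose P" "\<And>i. 0 < l i"
    using positive_definite_diagonalisable[OF assms] by blast
  have "mat_powr A 0 = P ** diag_mat (\<lambda>i. 1) ** transpose P"
    unfolding P(2) mat_powr_diagonalised[OF P(1)] using P(3) by (simp add: less_imp_neq[symmetric])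
  then show ?thesis using P(1) by (simp add: diag_mat_one orthogonal_matrix_def)
qed

lemma mat_powr_sym: "transpose A = A \<Longrightarrow> transpose (mat_powr A s) = mat_powr A s"
  using mat_powr_psd by (auto simp: psd_mats_def)

lemma matrix_inv_eqI:
  fixes A :: "real^'n^'n"
  assumes "A ** B = mat 1"
  shows "matrix_inv A = B"
proof -
  have BA: "B ** A = mat 1" using assms matrix_left_right_inverse by blast
  have "A ** matrix_inv A = mat 1 \<and> matrix_inv A ** A = mat 1"
    unfolding matrix_inv_def by (rule someI[of _ B]) (simp add: assms BA)
  then show ?thesis by (metis BA matrix_mul_assoc matrix_mul_lid matrix_mul_rid)
qed

lemma mat_powr_minus_one:
  assumes "positive_definite A"
  shows "mat_powr A (-1) = matrix_inv A"
proof -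
  have "A ** mat_powr A (-1) = mat 1"
    using mat_powr_add[OF assms, of 1 "-1"] by (simp add: mat_powr_one mat_powr_zero assms)
  then show ?thesis by (simp add: matrix_inv_eqI)
qed

lemma positive_definite_inv:
  assumes "positive_definite A"
  shows "A ** matrix_inv A = mat 1" "matrix_inv A ** A = mat 1"
    "transpose (matrix_inv A) = matrix_inv A"
proof -
  show "A ** matrix_inv A = mat 1" "matrix_inv A ** A = mat 1"
    using mat_powr_add[OF assms, of 1 "-1"] mat_powr_add[OF assms, of "-1" 1]
    by (simp_all add: mat_powr_one mat_powr_zero mat_powr_minus_one assms)
  have "transpose A = A" using assms by (simp add: positive_definite_def)
  from mat_powr_sym[OF this, of "-1"] show "transpose (matrix_inv A) = matrix_inv A"
    by (simp add: mat_powr_minus_one assms)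
qed

lemma positive_definite_congruence:
  fixes S :: "real^'n^'n"
  assumes B: "positive_definite B" and inj: "\<And>v. S *v v = 0 \<Longrightarrow> v = 0"
  shows "positive_definite (transpose S ** B ** S)"
proof -
  have "transpose B = B" using B by (simp add: positive_definite_def)
  moreover have "v \<bullet> ((transpose S ** B ** S) *v v) = (S *v v) \<bullet> (B *v (S *v v))" for v
    by (metis dot_lmul_matrix matrix_vector_mul_assoc transpose_matrix_vector transpose_transpose)
  ultimately show ?thesis using B inj
    by (auto simp: positive_definite_def matrix_transpose_mul matrix_mul_assoc)
qed

lemma matrix_inverse_inj:
  fixes A :: "real^'n^'n"
  assumes "B ** A = mat 1" "A *v v = 0"
  shows "v = 0"
proof -
  have "v = (B ** A) *v v" by (simp add: assms(1))
  also have "\<dots> = B *v (A *v v)" by (simp add: matrix_vector_mul_assoc)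
  finally show ?thesis by (simp add: assms(2))
qed

lemma positive_definite_square:
  fixes A :: "real^'n^'n"
  assumes "positive_definite A"
  shows "positive_definite (A ** A)"
proof -
  have I: "positive_definite (mat 1 :: real^'n^'n)"
    by (simp add: positive_definite_def transpose_mat)
  have "transpose A = A" using assms by (simp add: positive_definite_def)
  then show ?thesis
    using positive_definite_congruence[OF I, of A] matrix_inverse_inj[OF positive_definite_inv(2)[OF assms]]
    by (simp add: positive_definite_def)
qed

lemma positive_definite_diag:
  fixes l :: "'n::finite \<Rightarrow> real"
  assumes "\<And>i. 0 < l i"
  shows "positive_definite (diag_mat l)"
proof -
  have "v \<bullet> (diag_mat l *v v) = (\<Sum>i\<in>UNIV. l i * (v $ i)\<^sup>2)" for v
    using quadratic_form_diag[of v "mat 1" l] by (simp add: transpose_mat)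
  moreover have "0 < (\<Sum>i\<in>UNIV. l i * (v $ i)\<^sup>2)" if nz: "v \<noteq> 0" for v :: "real^'n"
  proof -
    obtain k where "v $ k \<noteq> 0" using nz by (auto simp: vec_eq_iff)
    then have "0 < l k * (v $ k)\<^sup>2" using assms by simp
    then show ?thesis by (intro sum_pos2[of _ k]) (use assms in \<open>auto simp: less_imp_le\<close>)
  qed
  ultimately show ?thesis by (simp add: positive_definite_def transpose_diag_mat)
qed

text \<open>With \<open>Q\<close> an orthogonal diagonalisation of
  \<open>mat_powr A (-1/2) ** B ** mat_powr A (-1/2)\<close>, the matrix
  \<open>S = transpose Q ** mat_powr A (1/2)\<close> undoes the conjugation. \<open>S\<close> is
  invertible but in general not orthogonal. One \<open>S\<close> serves all \<open>t\<close>, so the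
  quadratic forms of \<open>A\<close>, \<open>B\<close> and all their geometric means are weighted
  sums of the same squares.\<close>

lemma geo_mean_simultaneous_diag:
  fixes A B :: "real^'n^'n"
  assumes A: "positive_definite A" and B: "positive_definite B"
  obtains S :: "real^'n^'n" and l where "\<And>v. S *v v = 0 \<Longrightarrow> v = 0" "\<And>i. 0 < l i" "A = transpose S ** S"
    "B = transpose S ** diag_mat l ** S"
    "\<And>t. geo_mean t A B = transpose S ** diag_mat (\<lambda>i. l i powr t) ** S"
proof -
  define H K where "H = mat_powr A (1/2)" and "K = mat_powr A (-1/2)"
  have At: "transpose A = A" using A by (simp add: positive_definite_def)
  have H: "transpose H = H" and K: "transpose K = K"
    unfolding H_def K_def by (simp_all add: mat_powr_sym[OF At])
  have HH: "H ** H = A" and HK: "H ** K = mat 1" and KH: "K ** H = mat 1"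
    unfolding H_def K_def by (simp_all add: mat_powr_add[OF A] mat_powr_one[OF A] mat_powr_zero[OF A])
  have C: "positive_definite (K ** B ** K)"
    using positive_definite_congruence[OF B, of K] matrix_inverse_inj[OF HK] K by simp
  obtain Q l where Q: "orthogonal_matrix Q" "K ** B ** K = Q ** diag_mat l ** transpose Q"
    and l: "\<And>i. 0 < l i" using positive_definite_diagonalisable[OF C] by blast
  define S where "S = transpose Q ** H"
  have St: "transpose S = H ** Q" by (simp add: S_def matrix_transpose_mul H)
  have QQ: "Q ** transpose Q = mat 1" using Q(1) by (simp add: orthogonal_matrix_def)
  have conj: "transpose S ** D ** S = H ** (Q ** D ** transpose Q) ** H" for D
    unfolding St unfolding S_def by (simp add: matrix_mul_assoc)
  have "(K ** Q) ** S = mat 1" unfolding S_def by (metis KH QQ matrix_mul_assoc matrix_mul_rid)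
  then have "v = 0" if "S *v v = 0" for v using that by (rule matrix_inverse_inj)
  moreover have "A = transpose S ** S"
    using conj[of "mat 1"] by (simp add: QQ HH)
  moreover have "transpose S ** diag_mat l ** S = (H ** K) ** B ** (K ** H)"
    unfolding conj Q(2)[symmetric] by (simp add: matrix_mul_assoc)
  moreover have "geo_mean t A B = transpose S ** diag_mat (\<lambda>i. l i powr t) ** S" for t
    unfolding geo_mean_def conj using H_def K_def Q mat_powr_diagonalised[OF Q(1)] by simp
  ultimately show ?thesis using l that[of S l] by (simp add: HK KH)
qed

lemma norm_sq_eq_quadratic_form:
  fixes S :: "real^'n^'n"
  shows "(norm (S *v v))\<^sup>2 = v \<bullet> ((transpose S ** S) *v v)"
  by (metis dot_lmul_matrix matrix_vector_mul_assoc power2_norm_eq_inner transpose_matrix_vector transpose_transpose)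

lemma geo_mean_positive_definite:
  fixes A B :: "real^'n^'n"
  assumes "positive_definite A" "positive_definite B"
  shows "positive_definite (geo_mean t A B)"
proof -
  obtain S :: "real^'n^'n" and l where S: "\<And>v. S *v v = 0 \<Longrightarrow> v = 0" "\<And>i. 0 < l i"
    "geo_mean t A B = transpose S ** diag_mat (\<lambda>i. l i powr t) ** S"
    using geo_mean_simultaneous_diag[OF assms] by metis
  have "0 < l i powr t" for i using S(2)[of i] by simp
  from positive_definite_congruence[OF positive_definite_diag[OF this] S(1)]
  show ?thesis unfolding S(3) .
qed

lemma mat_powr_positive_definite:
  assumes "positive_definite A"
  shows "positive_definite (mat_powr A s)"
proof -
  obtain P l where P: "orthogonal_matrix P" "A = P ** diag_mat l ** transpose P" "\<And>i. 0 < l i"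
    using positive_definite_diagonalisable[OF assms] by blast
  have PP: "P ** transpose P = mat 1" using P(1) by (simp add: orthogonal_matrix_def)
  have pos: "0 < l i powr s" for i using P(3)[of i] by simp
  have "positive_definite (transpose (transpose P) ** diag_mat (\<lambda>i. l i powr s) ** transpose P)"
    by (rule positive_definite_congruence[OF positive_definite_diag[OF pos]]) (rule matrix_inverse_inj[OF PP])
  then show ?thesis unfolding P(2) mat_powr_diagonalised[OF P(1)] by simp
qed

text \<open>Assumes symmetry only, for use at the exceptional points where the weights are singular
  and the negative power in \<open>geo_mean\<close> is no inverse.\<close>

lemma geo_mean_symmetric:
  assumes A: "transpose A = A" and B: "transpose B = B"
  shows "transpose (geo_mean t A B) = geo_mean t A B"
proof -
  define H K where "H = mat_powr A (1/2)" and "K = mat_powr A (-1/2)"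
  have H: "transpose H = H" and K: "transpose K = K"
    unfolding H_def K_def by (simp_all only: mat_powr_sym[OF A])
  have "transpose (K ** B ** K) = K ** B ** K"
    by (simp add: matrix_transpose_mul K B matrix_mul_assoc)
  from mat_powr_sym[OF this, of t] show ?thesis
    unfolding geo_mean_def H_def[symmetric] K_def[symmetric]
    by (simp add: matrix_transpose_mul H matrix_mul_assoc)
qed

section \<open>Interpolation of quadratic forms\<close>

lemma op_norm_bound: "norm (A *v x) \<le> op_norm A * norm x"
  by (rule onorm) simp

lemma op_norm_nonneg: "0 \<le> op_norm A"
  by (rule onorm_pos_le) simp

lemma op_norm_mult: "op_norm (A ** B) \<le> op_norm A * op_norm B"
  for A B :: "real^'n^'n"
  using onorm_compose[of "(*v) A" "(*v) B"] by (simp add: o_def matrix_vector_mul_assoc)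

lemma op_norm_transpose_le:
  fixes A :: "real^'n^'n"
  shows "op_norm (transpose A) \<le> op_norm A"
proof (rule onorm_le)
  fix x
  have "(norm (transpose A *v x))\<^sup>2 = x \<bullet> (A *v (transpose A *v x))"
    by (simp add: power2_norm_eq_inner dot_lmul_matrix)
  also have "\<dots> \<le> norm x * (op_norm A * norm (transpose A *v x))"
    by (meson norm_cauchy_schwarz order_trans mult_left_mono norm_ge_zero op_norm_bound)
  finally have "norm (transpose A *v x) * norm (transpose A *v x)
      \<le> (op_norm A * norm x) * norm (transpose A *v x)"
    by (simp add: power2_eq_square mult_ac)
  then show "norm (transpose A *v x) \<le> op_norm A * norm x"
    by (cases "norm (transpose A *v x) = 0") (auto simp: op_norm_nonneg dest: mult_right_le_imp_le)
qed

lemma op_norm_transpose: "op_norm (transpose A) = op_norm A"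
  for A :: "real^'n^'n"
  by (metis op_norm_transpose_le order_antisym transpose_transpose)

text \<open>By the triangle inequality the operator norm is Lipschitz; the constant \<open>c\<close>
  is the number of entries, since an operator norm is at most that number times a bound on the
  entries. Continuity serves both the interpolation in the exponent and the measurability of
  kernels.\<close>

lemma continuous_on_op_norm: "continuous_on S (op_norm :: real^'n^'n \<Rightarrow> real)"
proof -
  define c where "c = real CARD('n) * real CARD('n)"
  have le: "op_norm A - op_norm B \<le> c * norm (A - B)" for A B :: "real^'n^'n"
  proof -
    have "op_norm A = onorm (\<lambda>x. (A - B) *v x + B *v x)"
      by (simp add: matrix_vector_mult_diff_rdistrib)
    also have "\<dots> \<le> op_norm (A - B) + op_norm B"
      by (rule onorm_triangle) simp_all
    also have "op_norm (A - B) \<le> c * norm (A - B)"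
      unfolding c_def
    proof (rule onorm_le_matrix_component)
      fix i j
      show "\<bar>(A - B) $ i $ j\<bar> \<le> norm (A - B)"
        by (rule order_trans[OF component_le_norm_cart Finite_Cartesian_Product.norm_nth_le])
    qed
    finally show ?thesis by simp
  qed
  have "dist (op_norm A) (op_norm B) \<le> c * dist A B" for A B :: "real^'n^'n"
    using le[of A B] le[of B A] by (simp add: dist_norm dist_real_def norm_minus_commute abs_le_iff)
  then have "c-lipschitz_on S (op_norm :: real^'n^'n \<Rightarrow> real)"
    by (intro lipschitz_onI) (simp_all add: c_def)
  then show ?thesis by (rule lipschitz_on_continuous_on)
qed

text \<open>The largest eigenvalue \<mu> of \<open>Y = transpose X ** X\<close> bounds the squared
  norm of \<open>X\<close>. The product \<open>Z\<close> of the transpose of the first perturbed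
  matrix with the second is \<open>D ** Y ** D'\<close>: the left factors cancel in the middle, and
  the outer ones form a similarity. So \<mu> is also an eigenvalue of \<open>Z\<close> and is at
  most the operator norm of \<open>Z\<close>. The two perturbed matrices will be the neighbours of
  \<open>X\<close> in a one-parameter family.\<close>

lemma op_norm_sq_le_op_norm_conj:
  fixes X L L' D D' :: "real^'n^'n"
  assumes L: "transpose L' ** L = mat 1" and D: "D' ** D = mat 1"
  shows "(op_norm X)\<^sup>2 \<le> op_norm (L' ** X ** transpose D) * op_norm (L ** X ** D')"
proof -
  define Y where "Y = transpose X ** X"
  have Y: "transpose Y = Y" by (simp add: Y_def matrix_transpose_mul)
  obtain e :: "real^'n" where "e \<noteq> 0" by (metis axis_eq_0_iff zero_neq_one)
  then obtain w \<mu> where w: "norm w = 1" "Y *v w = \<mu> *\<^sub>R w"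
    and max: "\<And>u. u \<bullet> (Y *v u) \<le> \<mu> * (norm u)\<^sup>2"
    using symmetric_rayleigh_max[OF Y subspace_UNIV, of e] by auto
  have X: "(norm (X *v u))\<^sup>2 \<le> \<mu> * (norm u)\<^sup>2" for u
    unfolding norm_sq_eq_quadratic_form using max[of u] by (simp add: Y_def)
  have \<mu>: "0 \<le> \<mu>" using X[of w] w(1) by (simp add: order_trans[OF zero_le_power2])
  have "op_norm X \<le> sqrt \<mu>"
  proof (rule onorm_le)
    show "norm (X *v u) \<le> sqrt \<mu> * norm u" for u
      using real_sqrt_le_mono[OF X[of u]] by (simp add: real_sqrt_mult)
  qed
  then have "(op_norm X)\<^sup>2 \<le> \<mu>"
    using \<mu> op_norm_nonneg[of X] by (metis power_mono real_sqrt_pow2)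
  also have "\<mu> \<le> op_norm (L' ** X ** transpose D) * op_norm (L ** X ** D')"
  proof -
    define Z where "Z = transpose (L' ** X ** transpose D) ** (L ** X ** D')"
    have "Z = D ** transpose X ** (transpose L' ** L) ** X ** D'"
      unfolding Z_def by (simp add: matrix_transpose_mul matrix_mul_assoc)
    then have Z: "Z = D ** Y ** D'" by (simp add: L Y_def matrix_mul_assoc)
    define z where "z = D *v w"
    have "Z *v z = (D ** Y ** (D' ** D)) *v w"
      unfolding Z z_def by (simp add: matrix_vector_mul_assoc matrix_mul_assoc)
    also have "\<dots> = D *v (Y *v w)" by (simp add: D matrix_vector_mul_assoc)
    also have "\<dots> = \<mu> *\<^sub>R z" by (simp add: w matrix_vector_mult_scaleR z_def)
    finally have "\<mu> * norm z = norm (Z *v z)" using \<mu> by simp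
    also have "\<dots> \<le> op_norm Z * norm z" by (rule op_norm_bound)
    finally have "\<mu> * norm z \<le> op_norm Z * norm z" .
    moreover have "z \<noteq> 0" using matrix_inverse_inj[OF D, of w] w(1) by (auto simp: z_def)
    ultimately have "\<mu> \<le> op_norm Z" by simp
    also have "\<dots> \<le> op_norm (L' ** X ** transpose D) * op_norm (L ** X ** D')"
      unfolding Z_def by (rule order_trans[OF op_norm_mult]) (simp only: op_norm_transpose)
    finally show ?thesis .
  qed
  finally show ?thesis .
qed

text \<open>If the bound failed, the leftmost maximiser would violate the midpoint inequality.\<close>
lemma midpoint_log_convex_le_one:
  fixes F :: "real \<Rightarrow> real"
  assumes cont: "continuous_on {0..1} F" and F0: "F 0 \<le> 1" and F1: "F 1 \<le> 1"
    and nonneg: "\<And>c. 0 \<le> F c"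
    and mid: "\<And>c d. c \<in> {0..1} \<Longrightarrow> c - d \<in> {0..1} \<Longrightarrow> c + d \<in> {0..1} \<Longrightarrow> (F c)\<^sup>2 \<le> F (c - d) * F (c + d)"
    and t: "t \<in> {0..1}"
  shows "F t \<le> 1"
proof (rule ccontr)
  assume "\<not> F t \<le> 1"
  obtain c0 where c0: "c0 \<in> {0..1}" and max: "\<And>c. c \<in> {0..1} \<Longrightarrow> F c \<le> F c0"
    using continuous_attains_sup[OF _ _ cont] by fastforce
  define M where "M = F c0"
  have M: "1 < M" using max[OF t] \<open>\<not> F t \<le> 1\<close> by (simp add: M_def)
  define T where "T = {0..1} \<inter> F -` {M}"
  have "closed T" unfolding T_def by (intro continuous_closed_preimage cont) simp_all
  moreover have "bounded T" unfolding T_def by (rule bounded_subset[of "{0..1}"]) auto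
  ultimately have T: "compact T" by (simp add: compact_eq_bounded_closed)
  have T0: "T \<noteq> {}" using c0 by (auto simp: T_def M_def)
  obtain c where c: "c \<in> T" and least: "\<And>x. x \<in> T \<Longrightarrow> c \<le> x"
    using compact_attains_inf[OF T T0] by blast
  have Fc: "F c = M" and "c \<in> {0..1}" using c by (auto simp: T_def)
  have "c \<noteq> 0" "c \<noteq> 1" using F0 F1 M Fc by auto
  with \<open>c \<in> {0..1}\<close> have "0 < c" "c < 1" by auto
  \<comment> \<open>Any positive step that keeps both neighbours in the unit interval would
    do.\<close>
  define d where "d = min c (1 - c)"
  have d: "0 < d" "c - d \<in> {0..1}" "c + d \<in> {0..1}"
    using \<open>0 < c\<close> \<open>c < 1\<close> by (auto simp: d_def)
  have "F (c - d) \<noteq> M" using least[of "c - d"] d by (auto simp: T_def)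
  then have less: "F (c - d) < M" using max[OF d(2)] by (simp add: M_def)
  have "M * M \<le> F (c - d) * F (c + d)"
    using mid[OF \<open>c \<in> {0..1}\<close> d(2,3)] by (simp add: Fc power2_eq_square)
  also have "\<dots> \<le> F (c - d) * M"
    using max[OF d(3)] nonneg by (intro mult_left_mono) (simp_all add: M_def)
  also have "\<dots> < M * M" using less M by simp
  finally show False by simp
qed

lemma norm_sq_diag_mat_powr_half:
  fixes x :: "real^'n"
  assumes "\<And>i. 0 < l i"
  shows "(norm (diag_mat (\<lambda>i. l i powr (c / 2)) *v x))\<^sup>2 = (\<Sum>i\<in>UNIV. l i powr c * (x $ i)\<^sup>2)"
proof -
  have "(l i powr (c / 2))\<^sup>2 = l i powr c" for i
    by (simp add: power2_eq_square powr_add[symmetric])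
  then show ?thesis
    by (simp add: norm_vec_def L2_set_def sum_nonneg diag_mat_vector power_mult_distrib)
qed

text \<open>With \<open>R'\<close> the inverse of \<open>R\<close>, the inequality with exponent
  \<open>c\<close> says that \<open>X c = L c ** (S ** R') ** D (- c)\<close> is a contraction; the
  hypotheses are the cases 0 and 1. Shifting the exponent by \<open>d\<close> multiplies by
  \<open>L d\<close> on the left and \<open>D (- d)\<close> on the right, and shifting it by
  \<open>- d\<close> multiplies by their inverses. This is the configuration of
  \<open>op_norm_sq_le_op_norm_conj\<close>, so the norm satisfies the midpoint inequality.\<close>

theorem weighted_quadratic_forms_interpolation:
  fixes S R :: "real^'n^'n"
  assumes l: "\<And>i. 0 < l i" and m: "\<And>i. 0 < m i" and R: "\<And>v. R *v v = 0 \<Longrightarrow> v = 0"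
    and h0: "\<And>v. (\<Sum>i\<in>UNIV. ((S *v v) $ i)\<^sup>2) \<le> (\<Sum>i\<in>UNIV. ((R *v v) $ i)\<^sup>2)"
    and h1: "\<And>v. (\<Sum>i\<in>UNIV. l i * ((S *v v) $ i)\<^sup>2) \<le> (\<Sum>i\<in>UNIV. m i * ((R *v v) $ i)\<^sup>2)"
    and t: "t \<in> {0..1}"
  shows "(\<Sum>i\<in>UNIV. l i powr t * ((S *v v) $ i)\<^sup>2) \<le> (\<Sum>i\<in>UNIV. m i powr t * ((R *v v) $ i)\<^sup>2)"
proof -
  obtain R' where R': "R ** R' = mat 1" "R' ** R = mat 1"
    by (metis R matrix_left_invertible_ker matrix_left_right_inverse)
  \<comment> \<open>Half the exponent, because the squared norm of \<open>L c *v x\<close> has to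
    carry the weights \<open>l i powr c\<close>.\<close>
  define L where "L c = diag_mat (\<lambda>i. l i powr (c / 2))" for c
  define D where "D c = diag_mat (\<lambda>i. m i powr (c / 2))" for c
  have Ladd: "L a ** L b = L (a + b)" and Dadd: "D a ** D b = D (a + b)" for a b
    by (simp_all add: L_def D_def diag_mat_mult powr_add[symmetric] add_divide_distrib)
  have L0: "L 0 = mat 1" and D0: "D 0 = mat 1"
    using l m by (simp_all add: L_def D_def diag_mat_one less_imp_neq[symmetric])
  have tr: "transpose (L c) = L c" "transpose (D c) = D c" for c
    by (simp_all add: L_def D_def transpose_diag_mat)
  define X where "X c = L c ** (S ** R') ** D (- c)" for c
  have XR: "X c *v (D c *v (R *v v)) = L c *v (S *v v)" for c v
  proof -
    have "X c ** D c ** R = L c ** S ** R' ** (D (- c) ** D c) ** R"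
      by (simp add: X_def matrix_mul_assoc)
    also have "\<dots> = L c ** S ** (R' ** R)" by (simp add: Dadd D0 matrix_mul_assoc)
    also have "\<dots> = L c ** S" by (simp add: R')
    finally show ?thesis by (metis matrix_vector_mul_assoc)
  qed
  have nL: "(norm (L c *v x))\<^sup>2 = (\<Sum>i\<in>UNIV. l i powr c * (x $ i)\<^sup>2)"
    and nD: "(norm (D c *v x))\<^sup>2 = (\<Sum>i\<in>UNIV. m i powr c * (x $ i)\<^sup>2)" for c x
    unfolding L_def D_def by (simp_all add: norm_sq_diag_mat_powr_half l m)
  \<comment> \<open>The hypotheses compare images of \<open>v\<close>; surjectivity turns them into
    bounds of \<open>X c\<close> on every vector.\<close>
  have surj: "\<exists>v. u = D c *v (R *v v)" for c u
  proof -
    have "D c ** R ** (R' ** D (- c)) = D c ** (R ** R') ** D (- c)" by (simp add: matrix_mul_assoc)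
    then have "u = D c *v (R *v ((R' ** D (- c)) *v u))"
      by (simp add: R' Dadd D0 matrix_vector_mul_assoc matrix_mul_assoc)
    then show ?thesis by blast
  qed
  have end_le: "op_norm (X c) \<le> 1"
    if le: "\<And>v. (norm (L c *v (S *v v)))\<^sup>2 \<le> (norm (D c *v (R *v v)))\<^sup>2" for c
  proof (rule onorm_le)
    fix u
    obtain v where v: "u = D c *v (R *v v)" using surj by blast
    show "norm (X c *v u) \<le> 1 * norm u"
      unfolding v XR using power2_le_imp_le[OF le[of v] norm_ge_zero] by simp
  qed
  have N: "op_norm (X t) \<le> 1"
  proof (rule midpoint_log_convex_le_one[of "\<lambda>c. op_norm (X c)"])
    have "X c = (\<chi> i j. l i powr (c / 2) * (S ** R') $ i $ j * m j powr (- c / 2))" for c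
      by (simp only: vec_eq_iff X_def L_def D_def mat_mult_diag_mat diag_mat_mult_mat vec_lambda_beta) simp
    moreover have "continuous_on {0..1} (\<lambda>c. \<chi> i j. l i powr (c / 2) * (S ** R') $ i $ j * m j powr (- c / 2))"
      using l m by (intro continuous_on_vec_lambda continuous_intros) (simp_all add: less_imp_neq[symmetric])
    ultimately have "continuous_on {0..1} X" by simp
    then show "continuous_on {0..1} (\<lambda>c. op_norm (X c))"
      by (rule continuous_on_compose2[OF continuous_on_op_norm[of UNIV]]) simp
    show "op_norm (X 0) \<le> 1"
      using h0 l m by (intro end_le) (simp add: nL nD less_imp_neq[symmetric])
    show "op_norm (X 1) \<le> 1"
      using h1 l m by (intro end_le) (simp add: nL nD less_imp_le)
    show "0 \<le> op_norm (X c)" for c by (rule op_norm_nonneg)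
    show "(op_norm (X c))\<^sup>2 \<le> op_norm (X (c - d)) * op_norm (X (c + d))" for c d
    proof -
      have "X (c - d) = L (- d) ** X c ** transpose (D d)"
      proof -
        have "L (- d) ** X c ** transpose (D d) = (L (- d) ** L c) ** (S ** R') ** (D (- c) ** D d)"
          by (simp add: X_def tr matrix_mul_assoc)
        then show ?thesis by (simp add: X_def Ladd Dadd)
      qed
      moreover have "X (c + d) = L d ** X c ** D (- d)"
      proof -
        have "L d ** X c ** D (- d) = (L d ** L c) ** (S ** R') ** (D (- c) ** D (- d))"
          by (simp add: X_def matrix_mul_assoc)
        then show ?thesis by (simp add: X_def Ladd Dadd add.commute)
      qed
      ultimately show ?thesis
        using op_norm_sq_le_op_norm_conj[of "L (- d)" "L d" "D (- d)" "D d" "X c"]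
        by (simp add: tr Ladd Dadd L0 D0)
    qed
  qed (rule t)
  have "norm (L t *v (S *v v)) \<le> op_norm (X t) * norm (D t *v (R *v v))"
    unfolding XR[symmetric] by (rule op_norm_bound)
  also have "\<dots> \<le> 1 * norm (D t *v (R *v v))" using N by (rule mult_right_mono) simp
  finally have "(norm (L t *v (S *v v)))\<^sup>2 \<le> (norm (D t *v (R *v v)))\<^sup>2"
    by (simp add: power_mono)
  then show ?thesis by (simp add: nL nD)
qed

lemma norm_sqrt_geo_mean:
  fixes A B :: "real^'n^'n"
  assumes "positive_definite A" "positive_definite B"
  shows "(norm (mat_powr (geo_mean t A B) (1/2) *v v))\<^sup>2 = v \<bullet> (geo_mean t A B *v v)"
proof -
  have G: "positive_definite (geo_mean t A B)" by (rule geo_mean_positive_definite[OF assms])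
  then have "transpose (mat_powr (geo_mean t A B) (1/2)) = mat_powr (geo_mean t A B) (1/2)"
    by (intro mat_powr_sym) (simp add: positive_definite_def)
  then show ?thesis
    by (simp add: norm_sq_eq_quadratic_form mat_powr_add[OF G] mat_powr_one[OF G])
qed

lemma norm_sq_positive_definite:
  assumes "positive_definite A"
  shows "(norm (A *v v))\<^sup>2 = v \<bullet> ((A ** A) *v v)"
  using assms by (simp add: norm_sq_eq_quadratic_form positive_definite_def)

theorem sqrt_geo_mean_interpolation:
  fixes A\<^sub>0 A\<^sub>1 B\<^sub>0 B\<^sub>1 :: "real^'n^'n"
  assumes A: "positive_definite A\<^sub>0" "positive_definite A\<^sub>1"
    and B: "positive_definite B\<^sub>0" "positive_definite B\<^sub>1"
    and pos: "0 < a" "0 < b"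
    and h0: "\<And>v. norm (A\<^sub>0 *v v) \<le> a * norm (B\<^sub>0 *v v)"
    and h1: "\<And>v. norm (A\<^sub>1 *v v) \<le> b * norm (B\<^sub>1 *v v)"
    and t: "t \<in> {0..1}"
  shows "norm (mat_powr (geo_mean t (A\<^sub>0 ** A\<^sub>0) (A\<^sub>1 ** A\<^sub>1)) (1/2) *v v)
    \<le> a powr (1 - t) * b powr t * norm (mat_powr (geo_mean t (B\<^sub>0 ** B\<^sub>0) (B\<^sub>1 ** B\<^sub>1)) (1/2) *v v)"
proof -
  note sqA = positive_definite_square[OF A(1)] positive_definite_square[OF A(2)]
  note sqB = positive_definite_square[OF B(1)] positive_definite_square[OF B(2)]
  obtain S :: "real^'n^'n" and l where S: "\<And>v. S *v v = 0 \<Longrightarrow> v = 0" "\<And>i. 0 < l i"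
    "A\<^sub>0 ** A\<^sub>0 = transpose S ** S" "A\<^sub>1 ** A\<^sub>1 = transpose S ** diag_mat l ** S"
    "\<And>t. geo_mean t (A\<^sub>0 ** A\<^sub>0) (A\<^sub>1 ** A\<^sub>1) = transpose S ** diag_mat (\<lambda>i. l i powr t) ** S"
    using geo_mean_simultaneous_diag[OF sqA] by metis
  obtain R :: "real^'n^'n" and m where R: "\<And>v. R *v v = 0 \<Longrightarrow> v = 0" "\<And>i. 0 < m i"
    "B\<^sub>0 ** B\<^sub>0 = transpose R ** R" "B\<^sub>1 ** B\<^sub>1 = transpose R ** diag_mat m ** R"
    "\<And>t. geo_mean t (B\<^sub>0 ** B\<^sub>0) (B\<^sub>1 ** B\<^sub>1) = transpose R ** diag_mat (\<lambda>i. m i powr t) ** R"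
    using geo_mean_simultaneous_diag[OF sqB] by metis
  have one: "transpose X ** X = transpose X ** diag_mat (\<lambda>i. 1) ** X" for X :: "real^'n^'n"
    by (simp add: diag_mat_one)
  have nA: "(norm (A\<^sub>0 *v v))\<^sup>2 = (\<Sum>i\<in>UNIV. ((S *v v) $ i)\<^sup>2)"
    "(norm (A\<^sub>1 *v v))\<^sup>2 = (\<Sum>i\<in>UNIV. l i * ((S *v v) $ i)\<^sup>2)"
    "(norm (mat_powr (geo_mean t (A\<^sub>0 ** A\<^sub>0) (A\<^sub>1 ** A\<^sub>1)) (1/2) *v v))\<^sup>2
      = (\<Sum>i\<in>UNIV. l i powr t * ((S *v v) $ i)\<^sup>2)" for v
    unfolding norm_sqrt_geo_mean[OF sqA] norm_sq_positive_definite[OF A(1)] norm_sq_positive_definite[OF A(2)]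
    unfolding S(5)
    unfolding S(3,4) one quadratic_form_diag by simp_all
  have nB: "(norm (B\<^sub>0 *v v))\<^sup>2 = (\<Sum>i\<in>UNIV. ((R *v v) $ i)\<^sup>2)"
    "(norm (B\<^sub>1 *v v))\<^sup>2 = (\<Sum>i\<in>UNIV. m i * ((R *v v) $ i)\<^sup>2)"
    "(norm (mat_powr (geo_mean t (B\<^sub>0 ** B\<^sub>0) (B\<^sub>1 ** B\<^sub>1)) (1/2) *v v))\<^sup>2
      = (\<Sum>i\<in>UNIV. m i powr t * ((R *v v) $ i)\<^sup>2)" for v
    unfolding norm_sqrt_geo_mean[OF sqB] norm_sq_positive_definite[OF B(1)] norm_sq_positive_definite[OF B(2)]
    unfolding R(5)
    unfolding R(3,4) one quadratic_form_diag by simp_all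
  \<comment> \<open>Rescaling absorbs the constants and leaves inequalities with constant 1:
    \<open>R'\<close> brings a factor a^2 into both forms on the right, and (b/a)^2 in
    \<open>m'\<close> corrects it to b^2 in the second. At exponent \<open>t\<close> the factor
    becomes (b/a)^(2t) a^2, the square of the claimed constant.\<close>
  define R' where "R' = a *\<^sub>R R"
  define m' where "m' i = m i * (b / a)\<^sup>2" for i
  have R'v: "R' *v v = a *\<^sub>R (R *v v)" for v by (simp add: R'_def scaleR_matrix_vector_assoc)
  have "(\<Sum>i\<in>UNIV. l i powr t * ((S *v v) $ i)\<^sup>2) \<le> (\<Sum>i\<in>UNIV. m' i powr t * ((R' *v v) $ i)\<^sup>2)"
  proof (rule weighted_quadratic_forms_interpolation[OF S(2) _ _ _ _ t])
    show "0 < m' i" for i using R(2)[of i] pos by (simp add: m'_def)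
    show "v = 0" if "R' *v v = 0" for v using that R(1)[of v] pos by (simp add: R'v)
    show "(\<Sum>i\<in>UNIV. ((S *v v) $ i)\<^sup>2) \<le> (\<Sum>i\<in>UNIV. ((R' *v v) $ i)\<^sup>2)" for v
    proof -
      have "(norm (A\<^sub>0 *v v))\<^sup>2 \<le> a\<^sup>2 * (norm (B\<^sub>0 *v v))\<^sup>2"
        using power_mono[OF h0[of v] norm_ge_zero, of 2] by (simp add: power_mult_distrib)
      then show ?thesis unfolding nA nB R'v by (simp add: power_mult_distrib sum_distrib_left)
    qed
    show "(\<Sum>i\<in>UNIV. l i * ((S *v v) $ i)\<^sup>2) \<le> (\<Sum>i\<in>UNIV. m' i * ((R' *v v) $ i)\<^sup>2)" for v
    proof -
      have "(norm (A\<^sub>1 *v v))\<^sup>2 \<le> b\<^sup>2 * (norm (B\<^sub>1 *v v))\<^sup>2"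
        using power_mono[OF h1[of v] norm_ge_zero, of 2] by (simp add: power_mult_distrib)
      moreover have "m' i * ((R' *v v) $ i)\<^sup>2 = b\<^sup>2 * (m i * ((R *v v) $ i)\<^sup>2)" for i
        using pos by (simp add: R'v m'_def power_mult_distrib power_divide)
      ultimately show ?thesis unfolding nA nB by (simp add: sum_distrib_left)
    qed
  qed
  moreover have "m' i powr t * ((R' *v v) $ i)\<^sup>2 = (a powr (1 - t) * b powr t)\<^sup>2 * (m i powr t * ((R *v v) $ i)\<^sup>2)" for i
  proof -
    have "((b / a)\<^sup>2) powr t = ((b / a) powr t)\<^sup>2"
    proof -
      have "r\<^sup>2 powr t = (r powr t)\<^sup>2" if "0 < r" for r :: real
        using that by (simp add: power2_eq_square powr_mult)
      then show ?thesis using pos by simp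
    qed
    then have "((b / a)\<^sup>2) powr t * a\<^sup>2 = ((b / a) powr t * a)\<^sup>2" by (simp add: power_mult_distrib)
    also have "(b / a) powr t * a = a powr (1 - t) * b powr t"
      using pos by (simp add: powr_divide powr_diff)
    finally have "((b / a)\<^sup>2) powr t * a\<^sup>2 = (a powr (1 - t) * b powr t)\<^sup>2" .
    moreover have "m' i powr t = m i powr t * ((b / a)\<^sup>2) powr t"
      using R(2)[of i] pos by (simp add: m'_def powr_mult)
    moreover have "((R' *v v) $ i)\<^sup>2 = a\<^sup>2 * ((R *v v) $ i)\<^sup>2" by (simp add: R'v power_mult_distrib)
    ultimately show ?thesis by (metis mult.assoc mult.commute)
  qed
  ultimately have "(norm (mat_powr (geo_mean t (A\<^sub>0 ** A\<^sub>0) (A\<^sub>1 ** A\<^sub>1)) (1/2) *v v))\<^sup>2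
    \<le> (a powr (1 - t) * b powr t * norm (mat_powr (geo_mean t (B\<^sub>0 ** B\<^sub>0) (B\<^sub>1 ** B\<^sub>1)) (1/2) *v v))\<^sup>2"
    unfolding power_mult_distrib[of _ "norm _"] nA nB by (simp add: sum_distrib_left)
  then show ?thesis by (rule power2_le_imp_le) simp
qed

lemma op_norm_pos:
  fixes A :: "real^'n^'n"
  assumes "B ** A = mat 1"
  shows "0 < op_norm A"
proof -
  obtain e :: "real^'n" where "e \<noteq> 0" by (metis axis_eq_0_iff zero_neq_one)
  then have "A *v e \<noteq> 0" using matrix_inverse_inj[OF assms] by blast
  then show ?thesis by (subst onorm_pos_lt) auto
qed

text \<open>The norm of \<open>M ** matrix_inv N\<close> is an admissible constant in comparing
  \<open>M *v v\<close> with \<open>N *v v\<close>, and it is strictly positive for invertible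
  matrices, as the rescaling by \<open>b / a\<close> requires. Applying the vector estimate to
  \<open>matrix_inv G *v x\<close> returns to operator norms.\<close>

theorem op_norm_sqrt_geo_mean_le:
  fixes A\<^sub>0 A\<^sub>1 B\<^sub>0 B\<^sub>1 :: "real^'n^'n"
  assumes A: "positive_definite A\<^sub>0" "positive_definite A\<^sub>1"
    and B: "positive_definite B\<^sub>0" "positive_definite B\<^sub>1"
    and t: "t \<in> {0..1}"
  shows "op_norm (mat_powr (geo_mean t (A\<^sub>0 ** A\<^sub>0) (A\<^sub>1 ** A\<^sub>1)) (1/2)
      ** matrix_inv (mat_powr (geo_mean t (B\<^sub>0 ** B\<^sub>0) (B\<^sub>1 ** B\<^sub>1)) (1/2)))
    \<le> op_norm (A\<^sub>0 ** matrix_inv B\<^sub>0) powr (1 - t) * op_norm (A\<^sub>1 ** matrix_inv B\<^sub>1) powr t"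
proof -
  have le: "norm (M *v v) \<le> op_norm (M ** matrix_inv N) * norm (N *v v)"
    if "positive_definite N" for M N :: "real^'n^'n" and v
  proof -
    have "(M ** matrix_inv N) *v (N *v v) = (M ** (matrix_inv N ** N)) *v v"
      by (simp add: matrix_vector_mul_assoc matrix_mul_assoc)
    also have "\<dots> = M *v v" by (simp add: positive_definite_inv(2)[OF that])
    finally show ?thesis by (metis op_norm_bound)
  qed
  have pos: "0 < op_norm (M ** matrix_inv N)"
    if "positive_definite M" "positive_definite N" for M N :: "real^'n^'n"
  proof (rule op_norm_pos)
    have "N ** matrix_inv M ** (M ** matrix_inv N) = N ** (matrix_inv M ** M) ** matrix_inv N"
      by (simp add: matrix_mul_assoc)
    then show "N ** matrix_inv M ** (M ** matrix_inv N) = mat 1"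
      by (simp add: positive_definite_inv that)
  qed
  define G where "G = mat_powr (geo_mean t (B\<^sub>0 ** B\<^sub>0) (B\<^sub>1 ** B\<^sub>1)) (1/2)"
  have G: "positive_definite G"
    unfolding G_def by (intro mat_powr_positive_definite geo_mean_positive_definite positive_definite_square B)
  show ?thesis unfolding G_def[symmetric]
  proof (rule onorm_le)
    fix x
    show "norm ((mat_powr (geo_mean t (A\<^sub>0 ** A\<^sub>0) (A\<^sub>1 ** A\<^sub>1)) (1/2) ** matrix_inv G) *v x)
      \<le> op_norm (A\<^sub>0 ** matrix_inv B\<^sub>0) powr (1 - t) * op_norm (A\<^sub>1 ** matrix_inv B\<^sub>1) powr t * norm x"
      using sqrt_geo_mean_interpolation[OF A B pos[OF A(1) B(1)] pos[OF A(2) B(2)] le[OF B(1)] le[OF B(2)] t,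
          of "matrix_inv G *v x"]
      by (simp add: G_def[symmetric] matrix_vector_mul_assoc positive_definite_inv(1)[OF G])
  qed
qed

section \<open>Measurability\<close>

text \<open>The entrywise notion of \<open>matrix_weight\<close>, for an arbitrary measure: it is
  also needed for normalised measures on cubes and on product spaces.\<close>

definition mat_measurable :: "'a measure \<Rightarrow> ('a \<Rightarrow> real^'n^'m) \<Rightarrow> bool" where
  "mat_measurable M A \<longleftrightarrow> (\<forall>i j. (\<lambda>x. A x $ i $ j) \<in> borel_measurable M)"

lemma mat_measurableD: "mat_measurable M A \<Longrightarrow> (\<lambda>x. A x $ i $ j) \<in> borel_measurable M"
  by (simp add: mat_measurable_def)

lemma mat_measurable_const: "mat_measurable M (\<lambda>x. C)"
  by (simp add: mat_measurable_def)

lemma mat_measurable_mult: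
  assumes "mat_measurable M A" "mat_measurable M B"
  shows "mat_measurable M (\<lambda>x. A x ** B x)"
  using assms unfolding mat_measurable_def matrix_matrix_mult_def
  by (auto intro!: borel_measurable_sum borel_measurable_times)

lemma mat_measurable_compose:
  assumes "mat_measurable M A" "f \<in> measurable N M"
  shows "mat_measurable N (\<lambda>x. A (f x))"
  using assms unfolding mat_measurable_def by (auto intro: measurable_compose)

lemma mat_measurable_borel:
  fixes A :: "'a \<Rightarrow> real^'n^'m"
  assumes "mat_measurable M A"
  shows "A \<in> borel_measurable M"
  by (rule borel_measurable_euclidean_space[THEN iffD2])
    (use assms in \<open>auto simp: Basis_vec_def inner_axis mat_measurable_def\<close>)

lemma op_norm_measurable:
  fixes A :: "'a \<Rightarrow> real^'n^'n"
  assumes "mat_measurable M A"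
  shows "(\<lambda>x. op_norm (A x)) \<in> borel_measurable M"
  by (rule measurable_compose[OF mat_measurable_borel[OF assms] borel_measurable_continuous_onI[OF continuous_on_op_norm]])

lemma norm_matrix_vector_measurable:
  fixes A :: "'a \<Rightarrow> real^'n^'n"
  assumes "mat_measurable M A"
  shows "(\<lambda>x. norm (A x *v v)) \<in> borel_measurable M"
proof -
  have "(\<lambda>x. (A x *v v) $ i) \<in> borel_measurable M" for i
    using assms unfolding matrix_vector_mult_def mat_measurable_def
    by (auto intro!: borel_measurable_sum borel_measurable_times)
  then show ?thesis unfolding norm_vec_def L2_set_def real_norm_def by measurable
qed

section \<open>Real matrix powers as limits of matrix polynomials\<close>

primrec mat_power :: "real^'n^'n \<Rightarrow> nat \<Rightarrow> real^'n^'n" where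
  "mat_power A 0 = mat 1"
| "mat_power A (Suc k) = A ** mat_power A k"

lemma mat_power_diagonalised:
  assumes "orthogonal_matrix P"
  shows "mat_power (P ** diag_mat l ** transpose P) k = P ** diag_mat (\<lambda>i. l i ^ k) ** transpose P"
proof (induction k)
  case 0
  then show ?case using assms by (simp add: diag_mat_one orthogonal_matrix_def)
next
  case (Suc k)
  then show ?case by (simp add: orthogonal_conj_mult[OF assms])
qed

lemma mat_measurable_mat_power:
  assumes "mat_measurable M A"
  shows "mat_measurable M (\<lambda>x. mat_power (A x) k)"
  by (induction k) (simp_all add: mat_measurable_const mat_measurable_mult assms)

lemma conj_diag_nth:
  "(P ** diag_mat l ** transpose P) $ i $ j = (\<Sum>k\<in>UNIV. P $ i $ k * l k * P $ j $ k)"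
  unfolding matrix_matrix_mult_def[of "P ** diag_mat l"] by (simp add: mat_mult_diag_mat transpose_def)

text \<open>Weierstrass approximation to within 1/(k+1) on the interval from 1/(k+1) to k+1. These
  intervals avoid 0, where negative powers blow up, and every positive \<open>x\<close> lies in all
  but finitely many of them, so one sequence of polynomials converges at all positive
  numbers.\<close>

lemma polynomial_powr_approximation:
  obtains a :: "nat \<Rightarrow> nat \<Rightarrow> real" and n
  where "\<And>x. 0 < x \<Longrightarrow> (\<lambda>k. \<Sum>i\<le>n k. a k i * x ^ i) \<longlonglongrightarrow> x powr s"
proof -
  have "\<exists>a n. \<forall>x\<in>{1 / real (Suc k)..real (Suc k)}. \<bar>x powr s - (\<Sum>i\<le>n. a i * x ^ i)\<bar> < 1 / real (Suc k)"
    for k :: nat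
  proof -
    have "0 \<notin> {1 / real (Suc k)..real (Suc k)}" by simp
    then have "continuous_on {1 / real (Suc k)..real (Suc k)} (\<lambda>x. x powr s)"
      by (intro continuous_intros) auto
    then obtain g where g: "real_polynomial_function g"
      "\<And>x. x \<in> {1 / real (Suc k)..real (Suc k)} \<Longrightarrow> \<bar>x powr s - g x\<bar> < 1 / real (Suc k)"
      by (rule Stone_Weierstrass_real_polynomial_function[OF compact_Icc _, of _ _ _ "1 / real (Suc k)"]) auto
    then show ?thesis unfolding real_polynomial_function_iff_sum by blast
  qed
  then obtain a n where an: "\<And>k x. x \<in> {1 / real (Suc k)..real (Suc k)} \<Longrightarrow>
      \<bar>x powr s - (\<Sum>i\<le>n k. a k i * x ^ i)\<bar> < 1 / real (Suc k)"
    by metis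
  show ?thesis
  proof (rule that)
    fix x :: real assume x: "0 < x"
    obtain k0 where k0: "max x (1 / x) < real k0" using reals_Archimedean2 by blast
    have in_range: "x \<in> {1 / real (Suc k)..real (Suc k)}" if "k0 \<le> k" for k
    proof -
      have *: "max x (1 / x) \<le> real (Suc k)" using k0 that by linarith
      then have "1 \<le> real (Suc k) * x" using x by (simp add: pos_divide_le_eq)
      then have "1 / real (Suc k) \<le> x" by (simp add: pos_divide_le_eq mult.commute)
      then show ?thesis using * by simp
    qed
    have diff: "(\<lambda>k. x powr s - (\<Sum>i\<le>n k. a k i * x ^ i)) \<longlonglongrightarrow> 0"
    proof (rule Lim_null_comparison)
      show "\<forall>\<^sub>F k in sequentially. norm (x powr s - (\<Sum>i\<le>n k. a k i * x ^ i)) \<le> 1 / real (Suc k)"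
        using an[OF in_range] by (auto simp: eventually_sequentially intro!: exI[of _ k0] less_imp_le)
      show "(\<lambda>k. 1 / real (Suc k)) \<longlonglongrightarrow> 0" by (rule LIMSEQ_Suc[OF lim_1_over_n])
    qed
    show "(\<lambda>k. \<Sum>i\<le>n k. a k i * x ^ i) \<longlonglongrightarrow> x powr s"
      using tendsto_diff[OF tendsto_const[of "x powr s"] diff] by simp
  qed
qed

text \<open>No measurable choice of eigenvectors is made: the entries of a polynomial in
  \<open>A x\<close> are measurable, and at a positive definite matrix the polynomials converge to
  the power because they do so on each eigenvalue. Elsewhere the limit \<open>B x\<close> need not
  agree with the power, but it is measurable all the same.\<close>

lemma mat_powr_measurable_version:
  fixes A :: "'a \<Rightarrow> real^'n^'n"
  assumes A: "mat_measurable M A"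
  obtains B where "mat_measurable M B" "\<And>x. positive_definite (A x) \<Longrightarrow> mat_powr (A x) s = B x"
proof -
  obtain a :: "nat \<Rightarrow> nat \<Rightarrow> real" and n
    where lim: "\<And>x. 0 < x \<Longrightarrow> (\<lambda>k. \<Sum>i\<le>n k. a k i * x ^ i) \<longlonglongrightarrow> x powr s"
    using polynomial_powr_approximation[of s] by metis
  define q where "q k X = (\<Sum>r\<le>n k. a k r *\<^sub>R mat_power X r)" for k and X :: "real^'n^'n"
  have q_nth: "q k X $ i $ j = (\<Sum>r\<le>n k. a k r * mat_power X r $ i $ j)" for k X i j
    by (simp add: q_def)
  have q_meas: "(\<lambda>x. q k (A x) $ i $ j) \<in> borel_measurable M" for k i j
    unfolding q_nth using mat_measurableD[OF mat_measurable_mat_power[OF A]]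
    by (intro borel_measurable_sum borel_measurable_times) auto
  have q_lim: "(\<lambda>k. q k X $ i $ j) \<longlonglongrightarrow> mat_powr X s $ i $ j"
    if pd: "positive_definite X" for X i j
  proof -
    obtain P l where P: "orthogonal_matrix P" "X = P ** diag_mat l ** transpose P"
      and l: "\<And>i. 0 < l i" using positive_definite_diagonalisable[OF pd] by metis
    have "q k X $ i $ j = (\<Sum>e\<in>UNIV. P $ i $ e * (\<Sum>r\<le>n k. a k r * l e ^ r) * P $ j $ e)" for k
    proof -
      have "q k X $ i $ j = (\<Sum>r\<le>n k. \<Sum>e\<in>UNIV. a k r * (P $ i $ e * l e ^ r * P $ j $ e))"
        by (simp add: q_nth P(2) mat_power_diagonalised[OF P(1)] conj_diag_nth sum_distrib_left)
      also have "\<dots> = (\<Sum>e\<in>UNIV. \<Sum>r\<le>n k. a k r * (P $ i $ e * l e ^ r * P $ j $ e))"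
        by (rule sum.swap)
      finally show ?thesis by (simp add: sum_distrib_left sum_distrib_right mult_ac)
    qed
    moreover have "mat_powr X s $ i $ j = (\<Sum>e\<in>UNIV. P $ i $ e * l e powr s * P $ j $ e)"
      unfolding P(2) mat_powr_diagonalised[OF P(1)] conj_diag_nth ..
    ultimately show ?thesis by (simp only:) (intro tendsto_intros lim l)
  qed
  define B where "B x = (\<chi> i j. lim (\<lambda>k. q k (A x) $ i $ j))" for x
  show ?thesis
  proof (rule that[of B])
    show "mat_measurable M B"
      unfolding mat_measurable_def B_def using q_meas by (simp add: borel_measurable_lim_metric)
    show "mat_powr (A x) s = B x" if "positive_definite (A x)" for x
      using limI[OF q_lim[OF that]] by (simp add: B_def vec_eq_iff)
  qed
qed

text \<open>Rests on the completeness of Lebesgue measure; it removes the difference between the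
  power and its measurable version.\<close>

lemma mat_measurable_AE_cong:
  fixes A B :: "'a::euclidean_space \<Rightarrow> real^'n^'m"
  assumes A: "mat_measurable lebesgue A" and eq: "AE x in lebesgue. A x = B x"
  shows "mat_measurable lebesgue B"
  unfolding mat_measurable_def
proof (intro allI)
  fix i j
  show "(\<lambda>x. B x $ i $ j) \<in> borel_measurable lebesgue"
    by (rule borel_measurable_AE[OF mat_measurableD[OF A]]) (use eq in eventually_elim, simp)
qed

lemma mat_measurable_mat_powr:
  fixes A :: "'a::euclidean_space \<Rightarrow> real^'n^'n"
  assumes A: "mat_measurable lebesgue A" and pd: "AE x in lebesgue. positive_definite (A x)"
  shows "mat_measurable lebesgue (\<lambda>x. mat_powr (A x) s)"
proof -
  obtain B where B: "mat_measurable lebesgue B" "\<And>x. positive_definite (A x) \<Longrightarrow> mat_powr (A x) s = B x"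
    using mat_powr_measurable_version[OF A] by metis
  show ?thesis
    by (rule mat_measurable_AE_cong[OF B(1)]) (use pd in eventually_elim, simp add: B(2))
qed

lemma mat_measurable_inv:
  fixes A :: "'a::euclidean_space \<Rightarrow> real^'n^'n"
  assumes A: "mat_measurable lebesgue A" and pd: "AE x in lebesgue. positive_definite (A x)"
  shows "mat_measurable lebesgue (\<lambda>x. matrix_inv (A x))"
  by (rule mat_measurable_AE_cong[OF mat_measurable_mat_powr[OF assms, of "-1"]])
    (use pd in eventually_elim, simp add: mat_powr_minus_one)

lemma mat_measurable_geo_mean:
  fixes A B :: "'a::euclidean_space \<Rightarrow> real^'n^'n"
  assumes A: "mat_measurable lebesgue A" "AE x in lebesgue. positive_definite (A x)"
    and B: "mat_measurable lebesgue B" "AE x in lebesgue. positive_definite (B x)"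
  shows "mat_measurable lebesgue (\<lambda>x. geo_mean t (A x) (B x))"
proof -
  define K where "K x = mat_powr (A x) (-1/2)" for x
  have "AE x in lebesgue. positive_definite (K x ** B x ** K x)"
    using A(2) B(2)
  proof eventually_elim
    case (elim x)
    have K: "positive_definite (K x)" unfolding K_def by (rule mat_powr_positive_definite[OF elim(1)])
    have "transpose (K x) = K x" using K by (simp add: positive_definite_def)
    moreover have "v = 0" if "K x *v v = 0" for v
      by (rule matrix_inverse_inj[OF positive_definite_inv(2)[OF K] that])
    ultimately show ?case using positive_definite_congruence[OF elim(2), of "K x"] by simp
  qed
  moreover have "mat_measurable lebesgue (\<lambda>x. K x ** B x ** K x)"
    unfolding K_def by (intro mat_measurable_mult mat_measurable_mat_powr A B)
  ultimately have T: "mat_measurable lebesgue (\<lambda>x. mat_powr (K x ** B x ** K x) t)"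
    by (rule mat_measurable_mat_powr[rotated])
  show ?thesis
    unfolding geo_mean_def K_def[symmetric]
    by (rule mat_measurable_mult[OF mat_measurable_mult[OF mat_measurable_mat_powr[OF A] T] mat_measurable_mat_powr[OF A]])
qed

lemma matrix_weight_sqrt_geo_mean:
  fixes W\<^sub>0 W\<^sub>1 :: "real^'n \<Rightarrow> real^'d^'d"
  assumes W0: "matrix_weight W\<^sub>0" and W1: "matrix_weight W\<^sub>1"
  shows "matrix_weight (\<lambda>x. mat_powr (geo_mean t (W\<^sub>0 x ** W\<^sub>0 x) (W\<^sub>1 x ** W\<^sub>1 x)) (1/2))"
proof -
  have meas: "mat_measurable lebesgue (\<lambda>x. W\<^sub>0 x ** W\<^sub>0 x)" "mat_measurable lebesgue (\<lambda>x. W\<^sub>1 x ** W\<^sub>1 x)"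
    using W0 W1 by (auto simp: matrix_weight_def mat_measurable_def[symmetric] intro!: mat_measurable_mult)
  have "AE x in lebesgue. positive_definite (W\<^sub>0 x)" "AE x in lebesgue. positive_definite (W\<^sub>1 x)"
    using W0 W1 by (auto simp: matrix_weight_def)
  then have pd: "AE x in lebesgue. positive_definite (W\<^sub>0 x ** W\<^sub>0 x)"
    "AE x in lebesgue. positive_definite (W\<^sub>1 x ** W\<^sub>1 x)"
    by (auto intro: positive_definite_square elim: eventually_mono)
  have pdG: "AE x in lebesgue. positive_definite (geo_mean t (W\<^sub>0 x ** W\<^sub>0 x) (W\<^sub>1 x ** W\<^sub>1 x))"
    using pd by eventually_elim (rule geo_mean_positive_definite)
  have sym: "transpose (W\<^sub>0 x ** W\<^sub>0 x) = W\<^sub>0 x ** W\<^sub>0 x" "transpose (W\<^sub>1 x ** W\<^sub>1 x) = W\<^sub>1 x ** W\<^sub>1 x" for x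
    using W0 W1 by (auto simp: matrix_weight_def psd_mats_def matrix_transpose_mul)
  show ?thesis
    unfolding matrix_weight_def mat_measurable_def[symmetric]
  proof (intro conjI allI)
    show "mat_powr (geo_mean t (W\<^sub>0 x ** W\<^sub>0 x) (W\<^sub>1 x ** W\<^sub>1 x)) (1/2) \<in> psd_mats" for x
      by (intro mat_powr_psd geo_mean_symmetric sym)
    show "mat_measurable lebesgue (\<lambda>x. mat_powr (geo_mean t (W\<^sub>0 x ** W\<^sub>0 x) (W\<^sub>1 x ** W\<^sub>1 x)) (1/2))"
      by (rule mat_measurable_mat_powr[OF mat_measurable_geo_mean[OF meas(1) pd(1) meas(2) pd(2)] pdG])
    show "AE x in lebesgue. positive_definite (mat_powr (geo_mean t (W\<^sub>0 x ** W\<^sub>0 x) (W\<^sub>1 x ** W\<^sub>1 x)) (1/2))"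
      using pdG by eventually_elim (rule mat_powr_positive_definite)
  qed
qed

section \<open>Hoelder's inequality and averages over cubes\<close>

lemma ennreal_powr_ennreal: "0 \<le> r \<Longrightarrow> ennreal_powr (ennreal r) a = ennreal (r powr a)"
  by (simp add: ennreal_powr_def)

lemma ennreal_powr_top [simp]: "ennreal_powr top a = top"
  by (simp add: ennreal_powr_def)

lemma ennreal_powr_0 [simp]: "ennreal_powr 0 a = 0"
  by (simp add: ennreal_powr_def)

lemma ennreal_powr_1 [simp]: "ennreal_powr x 1 = x"
  by (cases x) (auto simp: ennreal_powr_def)

lemma ennreal_powr_less_top: "ennreal_powr x a < \<infinity> \<longleftrightarrow> x < \<infinity>"
  by (cases x) (auto simp: ennreal_powr_def)

lemma ennreal_powr_mono:
  assumes "x \<le> y" "0 \<le> a"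
  shows "ennreal_powr x a \<le> ennreal_powr y a"
proof (cases "y = \<infinity>")
  case False
  then have "x \<noteq> \<infinity>" using assms(1) by (metis infinity_ennreal_def top.extremum_unique)
  then show ?thesis
    using False assms by (auto simp: ennreal_powr_def intro!: ennreal_leI powr_mono2 enn2real_mono simp: less_top)
qed simp

lemma ennreal_powr_powr: "ennreal_powr (ennreal_powr x a) b = ennreal_powr x (a * b)"
  by (cases x) (auto simp: ennreal_powr_def powr_powr)

lemma ennreal_powr_mult:
  assumes "0 < a"
  shows "ennreal_powr (x * y) a = ennreal_powr x a * ennreal_powr y a"
proof -
  have top: "ennreal_powr (\<infinity> * z) a = \<infinity> * ennreal_powr z a" for z
    using assms by (cases "z = 0"; cases z) (auto simp: ennreal_powr_def ennreal_top_mult)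
  consider "x = \<infinity>" | "y = \<infinity>" | r s where "0 \<le> r" "0 \<le> s" "x = ennreal r" "y = ennreal s"
    by (cases x; cases y) auto
  then show ?thesis
  proof cases
    case 1
    then show ?thesis using top[of y] by simp
  next
    case 2
    then show ?thesis using top[of x] by (simp add: mult.commute)
  next
    case 3
    then show ?thesis
      by (simp add: ennreal_mult[symmetric] ennreal_powr_ennreal powr_mult)
  qed
qed

lemma borel_measurable_ennreal_powr [measurable (raw)]:
  assumes "f \<in> borel_measurable M"
  shows "(\<lambda>x. ennreal_powr (f x) a) \<in> borel_measurable M"
  unfolding ennreal_powr_def using assms by measurable

text \<open>Young's inequality for \<open>x / K\<close> and \<open>y / L\<close>. In the application
  \<open>K\<close> and \<open>L\<close> are the integrals of the two functions, so that the bracket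
  integrates to \<open>a + b = 1\<close> and the prefactor is the Hoelder bound.\<close>

lemma ennreal_powr_Young:
  assumes ab: "0 < a" "0 < b" "a + b = 1" and K: "0 < K" and L: "0 < L"
  shows "ennreal_powr x a * ennreal_powr y b
    \<le> ennreal (K powr a * L powr b) * (ennreal (a / K) * x + ennreal (b / L) * y)"
proof -
  consider "x = \<infinity> \<or> y = \<infinity>" | r s where "0 \<le> r" "0 \<le> s" "x = ennreal r" "y = ennreal s"
    by (cases x; cases y) auto
  then show ?thesis
  proof cases
    case 1
    then have *: "ennreal (a / K) * x + ennreal (b / L) * y = \<infinity>"
      using ab K L by (auto simp: ennreal_mult_top)
    have "ennreal (K powr a * L powr b) \<noteq> 0" using K L by simp
    then show ?thesis unfolding * by (simp add: ennreal_mult_top)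
  next
    case 2
    have "r powr a * s powr b \<le> K powr a * L powr b * (a / K * r + b / L * s)"
    proof (cases "r = 0 \<or> s = 0")
      case True
      then show ?thesis using ab K L 2 by auto
    next
      case False
      then have "(r / K) powr a * (s / L) powr b \<le> a * (r / K) + b * (s / L)"
        using ab K L 2 by (intro Youngs_inequality_0) auto
      then have "K powr a * L powr b * ((r / K) powr a * (s / L) powr b)
          \<le> K powr a * L powr b * (a * (r / K) + b * (s / L))"
        by (intro mult_left_mono) simp_all
      moreover have "K powr a * L powr b * ((r / K) powr a * (s / L) powr b) = r powr a * s powr b"
        using K L 2 by (simp add: powr_divide)
      ultimately show ?thesis by simp
    qed
    then have "ennreal (r powr a * s powr b) \<le> ennreal (K powr a * L powr b * (a / K * r + b / L * s))"
      by (rule ennreal_leI)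
    moreover have "ennreal (K powr a * L powr b * (a / K * r + b / L * s))
        = ennreal (K powr a * L powr b) * (ennreal (a / K) * x + ennreal (b / L) * y)"
    proof -
      have "ennreal (a / K) * x = ennreal (a / K * r)" "ennreal (b / L) * y = ennreal (b / L * s)"
        unfolding 2 by (rule ennreal_mult[symmetric]; use ab K L 2 in simp)+
      moreover have "0 \<le> a / K * r" "0 \<le> b / L * s" using ab K L 2 by simp_all
      ultimately show ?thesis by (simp only: ennreal_mult ennreal_plus add_nonneg_nonneg mult_nonneg_nonneg powr_ge_zero)
    qed
    ultimately show ?thesis using 2 by (simp add: ennreal_powr_ennreal ennreal_mult)
  qed
qed

theorem nn_integral_Hoelder:
  assumes [measurable]: "F \<in> borel_measurable M" "G \<in> borel_measurable M"
    and ab: "0 < a" "0 < b" "a + b = 1"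
  shows "(\<integral>\<^sup>+x. ennreal_powr (F x) a * ennreal_powr (G x) b \<partial>M)
    \<le> ennreal_powr (\<integral>\<^sup>+x. F x \<partial>M) a * ennreal_powr (\<integral>\<^sup>+x. G x \<partial>M) b"
proof -
  define I J where "I = (\<integral>\<^sup>+x. F x \<partial>M)" and "J = (\<integral>\<^sup>+x. G x \<partial>M)"
  \<comment> \<open>Young's inequality needs positive finite scaling. A vanishing integral makes its
    function, and hence the product, vanish almost everywhere; an infinite one beside a nonzero one
    makes the right-hand side infinite.\<close>
  consider "I = 0" | "J = 0" | "I \<noteq> 0" "J = \<infinity>" | "J \<noteq> 0" "I = \<infinity>"
    | K L where "0 < K" "0 < L" "I = ennreal K" "J = ennreal L"
    by (cases I; cases J) (auto simp: less_le)
  then show ?thesis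
  proof cases
    case 1
    then have "AE x in M. F x = 0" unfolding I_def by (subst (asm) nn_integral_0_iff_AE) simp_all
    then have "(\<integral>\<^sup>+x. ennreal_powr (F x) a * ennreal_powr (G x) b \<partial>M) = 0"
      by (subst nn_integral_0_iff_AE) (auto elim: eventually_mono)
    then show ?thesis by simp
  next
    case 2
    then have "AE x in M. G x = 0" unfolding J_def by (subst (asm) nn_integral_0_iff_AE) simp_all
    then have "(\<integral>\<^sup>+x. ennreal_powr (F x) a * ennreal_powr (G x) b \<partial>M) = 0"
      by (subst nn_integral_0_iff_AE) (auto elim: eventually_mono)
    then show ?thesis by simp
  next
    case 3
    have "ennreal_powr I a \<noteq> 0" using 3(1) by (cases I) (auto simp: ennreal_powr_def)
    then show ?thesis using 3 by (simp add: I_def[symmetric] J_def[symmetric] ennreal_mult_top)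
  next
    case 4
    have "ennreal_powr J b \<noteq> 0" using 4(1) by (cases J) (auto simp: ennreal_powr_def)
    then show ?thesis using 4 by (simp add: I_def[symmetric] J_def[symmetric] ennreal_top_mult)
  next
    case 5
    have "(\<integral>\<^sup>+x. ennreal_powr (F x) a * ennreal_powr (G x) b \<partial>M)
      \<le> (\<integral>\<^sup>+x. ennreal (K powr a * L powr b) * (ennreal (a / K) * F x + ennreal (b / L) * G x) \<partial>M)"
      by (intro nn_integral_mono ennreal_powr_Young ab 5)
    also have "\<dots> = ennreal (K powr a * L powr b) * (ennreal (a / K) * I + ennreal (b / L) * J)"
      by (simp add: nn_integral_cmult nn_integral_add I_def J_def)
    also have "ennreal (a / K) * I + ennreal (b / L) * J = 1"
      using 5 ab by (simp add: ennreal_mult[symmetric] ennreal_plus[symmetric] del: ennreal_plus)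
    finally show ?thesis
      using 5 by (simp add: I_def[symmetric] J_def[symmetric] ennreal_powr_ennreal ennreal_mult)
  qed
qed

section \<open>Averages as integrals against normalised Lebesgue measure\<close>

abbreviation unif :: "(real^'n) set \<Rightarrow> (real^'n) measure" where
  "unif Q \<equiv> uniform_measure lebesgue Q"

lemma cube_emeasure:
  fixes Q :: "(real^'n) set"
  assumes "Q \<in> cubes"
  shows "Q \<in> sets lebesgue" "emeasure lebesgue Q \<noteq> 0" "emeasure lebesgue Q < \<infinity>"
proof -
  obtain a s where Q: "Q = cbox a (a + (\<chi> i. s))" and s: "0 < s"
    using assms by (auto simp: cubes_def)
  show "Q \<in> sets lebesgue" unfolding Q by simp
  have "emeasure lebesgue Q = emeasure lborel (cbox a (a + (\<chi> i. s)))"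
    unfolding Q by (simp add: emeasure_completion main_part_sets)
  also have "\<dots> = (\<Prod>b\<in>Basis. (a + (\<chi> i. s) - a) \<bullet> b)"
    by (rule emeasure_lborel_cbox) (use s in \<open>auto simp: Basis_vec_def inner_axis inner_add_left\<close>)
  finally have eq: "emeasure lebesgue Q = ennreal (\<Prod>b\<in>Basis. (\<chi> i. s) \<bullet> (b::real^'n))" by simp
  have pos: "0 < (\<Prod>b\<in>Basis. (\<chi> i. s) \<bullet> (b::real^'n))"
    by (rule prod_pos) (use s in \<open>auto simp: Basis_vec_def inner_axis\<close>)
  show "emeasure lebesgue Q \<noteq> 0" unfolding eq using pos by (simp only: ennreal_eq_0_iff not_le)
  show "emeasure lebesgue Q < \<infinity>" unfolding eq by simp
qed

lemma prob_space_unif: "Q \<in> cubes \<Longrightarrow> prob_space (unif Q)"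
  using cube_emeasure[of Q] by (intro prob_space_uniform_measure) auto

lemma AE_unif_iff: "Q \<in> cubes \<Longrightarrow> (AE x in unif Q. P x) \<longleftrightarrow> (AE x in lebesgue. x \<in> Q \<longrightarrow> P x)"
  using cube_emeasure[of Q] by (intro AE_uniform_measure) auto

lemma AE_unifI: "Q \<in> cubes \<Longrightarrow> AE x in lebesgue. P x \<Longrightarrow> AE x in unif Q. P x"
  by (subst AE_unif_iff) (auto elim: eventually_mono)

lemma average_eq_nn_integral:
  assumes "Q \<in> cubes" "f \<in> borel_measurable lebesgue"
  shows "average Q f = (\<integral>\<^sup>+x. f x \<partial>unif Q)"
  unfolding average_def using cube_emeasure(1)[OF assms(1)] assms(2)
  by (simp add: nn_integral_uniform_measure)

section \<open>Auerbach bases\<close>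

lemma norm_matrix_vector_le_columns:
  fixes A :: "real^'n^'m"
  shows "norm (A *v u) \<le> (\<Sum>j\<in>UNIV. norm (column j A)) * norm u"
proof -
  have "norm (A *v u) \<le> (\<Sum>j\<in>UNIV. norm (u $ j *s column j A))"
    unfolding matrix_mult_sum by (rule norm_sum)
  also have "\<dots> \<le> (\<Sum>j\<in>UNIV. norm (column j A) * norm u)"
  proof (rule sum_mono)
    fix j
    have "norm (u $ j *s column j A) = \<bar>u $ j\<bar> * norm (column j A)"
      by (simp add: scalar_mult_eq_scaleR)
    also have "\<dots> \<le> norm u * norm (column j A)"
      by (intro mult_right_mono component_le_norm_cart) simp
    finally show "norm (u $ j *s column j A) \<le> norm (column j A) * norm u" by (simp add: mult.commute)
  qed
  finally show ?thesis by (simp add: sum_distrib_right)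
qed

text \<open>The columns of \<open>V\<close> form an Auerbach basis: they maximise the determinant over the unit ball
  of \<open>\<rho>\<close>, and Cramer's rule then bounds the coordinates.\<close>
theorem Auerbach_basis:
  fixes \<rho> :: "real^'n \<Rightarrow> real"
  assumes triangle: "\<And>x y. \<rho> (x + y) \<le> \<rho> x + \<rho> y"
    and scale: "\<And>c x. \<rho> (c *\<^sub>R x) = \<bar>c\<bar> * \<rho> x"
    and definite: "\<And>x. \<rho> x = 0 \<Longrightarrow> x = 0"
    and bound: "\<And>x. \<rho> x \<le> K * norm x"
  obtains V V' :: "real^'n^'n" where "V ** V' = mat 1" "\<And>j. \<rho> (column j V) \<le> 1"
    "\<And>w k. \<bar>(V' *v w) $ k\<bar> \<le> \<rho> w"
proof -
  have \<rho>0: "\<rho> 0 = 0" using scale[of 0 0] by simp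
  have \<rho>_minus: "\<rho> (- x) = \<rho> x" for x using scale[of "-1" x] by simp
  have \<rho>_nonneg: "0 \<le> \<rho> x" for x
    using triangle[of x "- x"] by (simp add: \<rho>0 \<rho>_minus)
  have K0: "0 \<le> K"
    using order_trans[OF \<rho>_nonneg bound, of "axis undefined 1"] by simp
  have diff: "\<rho> x - \<rho> y \<le> K * dist x y" for x y
    using triangle[of "x - y" y] bound[of "x - y"] by (simp add: dist_norm)
  have "K-lipschitz_on UNIV \<rho>"
  proof (rule lipschitz_onI)
    show "dist (\<rho> x) (\<rho> y) \<le> K * dist x y" for x y
      using diff[of x y] diff[of y x] by (simp add: dist_real_def dist_commute abs_le_iff)
  qed (rule K0)
  then have cont: "continuous_on UNIV \<rho>" by (rule lipschitz_on_continuous_on)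
  \<comment> \<open>The minimum of \<rho> on the unit sphere; it is positive by definiteness and
    makes the set of admissible matrices bounded.\<close>
  obtain c where c: "0 < c" and lower: "\<And>x. c * norm x \<le> \<rho> x"
  proof -
    have "sphere 0 1 \<noteq> ({} :: (real^'n) set)" by simp
    then obtain e where e: "e \<in> sphere 0 1" and min: "\<And>x. x \<in> sphere 0 1 \<Longrightarrow> \<rho> e \<le> \<rho> x"
      using continuous_attains_inf[OF compact_sphere _ continuous_on_subset[OF cont subset_UNIV]] by blast
    have "\<rho> e \<noteq> 0" using definite[of e] e by auto
    then have pos: "0 < \<rho> e" using \<rho>_nonneg[of e] by simp
    have "\<rho> e * norm x \<le> \<rho> x" for x
    proof (cases "x = 0")
      case False
      then have "\<rho> e \<le> \<rho> (x /\<^sub>R norm x)" by (intro min) simp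
      then have "\<rho> e \<le> \<rho> x / norm x" unfolding scale by (simp add: divide_inverse mult.commute)
      then show ?thesis using False by (simp add: pos_le_divide_eq)
    qed (simp add: \<rho>0)
    with pos show thesis by (rule that)
  qed
  define T :: "(real^'n^'n) set" where "T = {V. \<forall>j. \<rho> (column j V) \<le> 1}"
  have col: "column j V = (\<chi> i. V $ i $ j)" for j and V :: "real^'n^'n" by (simp add: column_def)
  have cont_col: "continuous_on UNIV (\<lambda>V :: real^'n^'n. \<rho> (column j V))" for j
    unfolding col by (rule continuous_on_compose2[OF cont]) (auto intro!: continuous_intros)
  have "closed (\<Inter>j. {V :: real^'n^'n. \<rho> (column j V) \<le> 1})"
    by (intro closed_INT ballI closed_Collect_le cont_col continuous_on_const)
  then have closed: "closed T" by (simp add: T_def flip: Collect_all_eq)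
  have "bounded T"
    unfolding bounded_iff
  proof (intro exI ballI)
    fix V assume V: "V \<in> T"
    have "norm V \<le> (\<Sum>i\<in>UNIV. norm (V $ i))" unfolding norm_vec_def by (rule L2_set_le_sum) simp
    also have "\<dots> \<le> (\<Sum>i\<in>(UNIV::'n set). \<Sum>j\<in>(UNIV::'n set). 1 / c)"
    proof (rule sum_mono)
      fix i
      have "norm (V $ i) \<le> (\<Sum>j\<in>UNIV. \<bar>V $ i $ j\<bar>)" by (rule norm_le_l1_cart)
      also have "\<dots> \<le> (\<Sum>j\<in>(UNIV::'n set). 1 / c)"
      proof (rule sum_mono)
        fix j
        have "c * norm (column j V) \<le> 1" using lower[of "column j V"] V by (auto simp: T_def intro: order_trans)
        then have "norm (column j V) \<le> 1 / c" using c by (simp add: pos_le_divide_eq mult.commute)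
        moreover have "\<bar>V $ i $ j\<bar> \<le> norm (column j V)"
          using component_le_norm_cart[of "column j V" i] by (simp add: column_def)
        ultimately show "\<bar>V $ i $ j\<bar> \<le> 1 / c" by simp
      qed
      finally show "norm (V $ i) \<le> (\<Sum>j\<in>(UNIV::'n set). 1 / c)" .
    qed
    finally show "norm V \<le> (\<Sum>i\<in>(UNIV::'n set). \<Sum>j\<in>(UNIV::'n set). 1 / c)" .
  qed
  with closed have compact: "compact T" by (simp add: compact_eq_bounded_closed)
  \<comment> \<open>A multiple of the identity small enough to be admissible: it shows that
    \<open>T\<close> is nonempty and that the maximal determinant is nonzero. Using
    \<open>K + 1\<close> avoids a separate case \<open>K = 0\<close>.\<close>
  define E :: "real^'n^'n" where "E = (1 / (K + 1)) *\<^sub>R mat 1"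
  have "E \<in> T"
    unfolding T_def
  proof clarify
    fix j
    have "column j E = (1 / (K + 1)) *\<^sub>R axis j 1"
      by (simp add: E_def column_def mat_def axis_def vec_eq_iff)
    then have "\<rho> (column j E) = \<rho> (axis j 1) / (K + 1)" using K0 by (simp add: scale)
    also have "\<dots> \<le> K / (K + 1)" using bound[of "axis j 1"] K0 by (intro divide_right_mono) simp_all
    also have "\<dots> \<le> 1" using K0 by simp
    finally show "\<rho> (column j E) \<le> 1" .
  qed
  then have ne: "T \<noteq> {}" by blast
  have "continuous_on T (\<lambda>V. \<bar>det V\<bar>)"
    unfolding det_def by (intro continuous_intros)
  then obtain V where V: "V \<in> T" and max: "\<And>U. U \<in> T \<Longrightarrow> \<bar>det U\<bar> \<le> \<bar>det V\<bar>"
    using continuous_attains_sup[OF compact ne] by blast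
  have "E ** ((K + 1) *\<^sub>R mat 1) = mat 1"
    using K0 by (simp add: E_def matrix_scalar_ac scalar_matrix_assoc[symmetric])
  then have "invertible E" by (metis invertible_right_inverse)
  then have "det E \<noteq> 0" by (simp add: invertible_det_nz)
  then have det: "det V \<noteq> 0" using max[OF \<open>E \<in> T\<close>] by auto
  then obtain V' where V': "V ** V' = mat 1" by (metis invertible_det_nz invertible_right_inverse)
  have le1: "\<bar>(V' *v w) $ k\<bar> \<le> 1" if w: "\<rho> w \<le> 1" for w k
  proof -
    define x where "x = V' *v w"
    have Vx: "V *v x = w" by (simp add: x_def matrix_vector_mul_assoc V')
    \<comment> \<open>Replacing column \<open>k\<close> of \<open>V\<close> by \<open>w\<close>
      stays in \<open>T\<close> and multiplies the determinant by the \<open>k\<close>-th coordinate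
      of \<open>w\<close>, so maximality bounds that coordinate by 1.\<close>
    define U where "U = (\<chi> i j. if j = k then (V *v x) $ i else V $ i $ j)"
    have "column j U = (if j = k then w else column j V)" for j
      by (simp add: U_def Vx column_def vec_eq_iff)
    then have "U \<in> T" using V w by (simp add: T_def)
    then have "\<bar>x $ k * det V\<bar> \<le> \<bar>det V\<bar>"
      using max[of U] unfolding U_def cramer_lemma by simp
    then show ?thesis using det by (simp add: abs_mult x_def)
  qed
  have "\<bar>(V' *v w) $ k\<bar> \<le> \<rho> w" for w k
  proof (cases "w = 0")
    case False
    then have pos: "0 < \<rho> w" using definite[of w] \<rho>_nonneg[of w] by (auto simp: less_le)
    then have "\<rho> (w /\<^sub>R \<rho> w) \<le> 1" by (simp add: scale)
    from le1[OF this, of k] show ?thesis using pos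
      by (simp add: matrix_vector_mult_scaleR abs_mult) (simp add: divide_inverse[symmetric] field_simps)
  qed (simp add: \<rho>0)
  with V' V show ?thesis by (intro that) (auto simp: T_def)
qed

section \<open>Interpolation of mixed norms\<close>

lemma column_mult: "column j (A ** B) = A *v column j B"
  by (simp add: vec_eq_iff column_def matrix_matrix_mult_def matrix_vector_mult_def)

text \<open>With \<open>V\<close> an Auerbach basis of \<rho>, the kernel matrix factors as
  \<open>(W x ** V) ** (V' ** matrix_inv (W y))\<close>. The norm of the first factor is at most the
  sum of its column norms, whose averages are \<rho>(column j V) \<le> 1. For the second, each
  coordinate functional is bounded by \<rho>, and the A_1 bound at \<open>y\<close> gives \<rho>
  \<le> \<open>M * norm u\<close> at \<open>matrix_inv (W y) *v u\<close>; summing the coordinates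
  costs the dimension. The exceptional set of \<open>y\<close> does not depend on
  \<open>x\<close>.\<close>

lemma A1_imp_separated_bound:
  fixes W :: "'a \<Rightarrow> real^'n^'n"
  assumes N: "prob_space N" and W: "mat_measurable N W" and pd: "AE x in N. positive_definite (W x)"
    and bound: "\<And>x v. norm (W x *v v) \<le> K * norm v" and M: "0 \<le> M"
    and A1: "AE y in N. (\<integral>\<^sup>+x. op_norm (W x ** matrix_inv (W y)) \<partial>N) \<le> ennreal M"
  obtains H where "H \<in> borel_measurable N" "(\<integral>\<^sup>+x. H x \<partial>N) \<le> ennreal (real CARD('n) * real CARD('n) * M)"
    "AE y in N. \<forall>x. ennreal (op_norm (W x ** matrix_inv (W y))) \<le> H x"
proof -
  interpret prob_space N by fact
  \<comment> \<open>Here the boundedness of the weight enters: it makes \<rho> a finite, continuous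
    norm.\<close>
  have int: "integrable N (\<lambda>x. norm (W x *v v))" for v
    by (rule integrable_const_bound[of _ "K * norm v"])
      (use bound norm_matrix_vector_measurable[OF W] in auto)
  define \<rho> where "\<rho> v = (LINT x|N. norm (W x *v v))" for v
  have \<rho>_bound: "\<rho> v \<le> K * norm v" for v
    unfolding \<rho>_def by (rule integral_le_const[OF int]) (use bound in auto)
  obtain V V' :: "real^'n^'n" where V: "V ** V' = mat 1" "\<And>j. \<rho> (column j V) \<le> 1"
    "\<And>w k. \<bar>(V' *v w) $ k\<bar> \<le> \<rho> w"
  proof (rule Auerbach_basis[of \<rho>, OF _ _ _ \<rho>_bound])
    show "\<rho> (x + y) \<le> \<rho> x + \<rho> y" for x y
      unfolding \<rho>_def Bochner_Integration.integral_add[OF int int, symmetric]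
      by (intro integral_mono Bochner_Integration.integrable_add int)
        (simp add: matrix_vector_right_distrib norm_triangle_ineq)
    show "\<rho> (c *\<^sub>R x) = \<bar>c\<bar> * \<rho> x" for c x
      by (simp add: \<rho>_def matrix_vector_mult_scaleR)
    show "x = 0" if "\<rho> x = 0" for x
    proof -
      \<comment> \<open>A vector of zero average norm is killed by almost every \<open>W y\<close>,
        and almost every \<open>W y\<close> is invertible; since \<open>N\<close> has mass 1, at
        least one such \<open>y\<close> exists.\<close>
      have "AE y in N. norm (W y *v x) = 0"
        using that integral_nonneg_eq_0_iff_AE[OF int] unfolding \<rho>_def by simp
      then have "AE y in N. x = 0"
        using pd by eventually_elim (auto intro: matrix_inverse_inj[OF positive_definite_inv(2)])
      then show ?thesis by simp
    qed
  qed (use that in blast)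
  define H where "H x = ennreal (real CARD('n) * M * (\<Sum>j\<in>UNIV. norm (W x *v column j V)))" for x
  show ?thesis
  proof (rule that)
    show "H \<in> borel_measurable N"
      unfolding H_def using norm_matrix_vector_measurable[OF W] by measurable
    have "(\<integral>\<^sup>+x. H x \<partial>N) = ennreal (LINT x|N. real CARD('n) * M * (\<Sum>j\<in>UNIV. norm (W x *v column j V)))"
      unfolding H_def using M int by (intro nn_integral_eq_integral) (auto intro!: AE_I2 mult_nonneg_nonneg sum_nonneg)
    also have "(LINT x|N. real CARD('n) * M * (\<Sum>j\<in>UNIV. norm (W x *v column j V)))
        = real CARD('n) * M * (\<Sum>j\<in>UNIV. \<rho> (column j V))"
      using int by (simp add: \<rho>_def)
    also have "\<dots> \<le> real CARD('n) * M * (\<Sum>j\<in>(UNIV::'n set). 1)"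
      using M V(2) by (intro mult_left_mono sum_mono) auto
    finally show "(\<integral>\<^sup>+x. H x \<partial>N) \<le> ennreal (real CARD('n) * real CARD('n) * M)"
      by (simp add: mult_ac ennreal_leI)
    show "AE y in N. \<forall>x. ennreal (op_norm (W x ** matrix_inv (W y))) \<le> H x"
      using A1
    proof eventually_elim
      case (elim y)
      define Z where "Z = matrix_inv (W y)"
      have meas: "(\<lambda>x. op_norm (W x ** Z)) \<in> borel_measurable N"
        by (intro op_norm_measurable mat_measurable_mult W mat_measurable_const)
      \<comment> \<open>The only place where the A_1 bound at the fixed \<open>y\<close> is used: it
        is exactly the average over \<open>x\<close> of the operator norm of
        \<open>W x ** Z\<close>.\<close>
      have \<rho>Z: "\<rho> (Z *v u) \<le> M * norm u" for u
      proof -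
        have "ennreal (\<rho> (Z *v u)) = (\<integral>\<^sup>+x. norm (W x *v (Z *v u)) \<partial>N)"
          unfolding \<rho>_def by (rule nn_integral_eq_integral[symmetric, OF int]) simp
        also have "\<dots> \<le> (\<integral>\<^sup>+x. ennreal (op_norm (W x ** Z)) * ennreal (norm u) \<partial>N)"
        proof (rule nn_integral_mono)
          fix x
          have "norm (W x *v (Z *v u)) \<le> op_norm (W x ** Z) * norm u"
            using op_norm_bound[of "W x ** Z" u] by (simp add: matrix_vector_mul_assoc)
          then show "ennreal (norm (W x *v (Z *v u))) \<le> ennreal (op_norm (W x ** Z)) * ennreal (norm u)"
            by (simp add: ennreal_mult[symmetric] op_norm_nonneg ennreal_leI)
        qed
        also have "\<dots> = (\<integral>\<^sup>+x. ennreal (op_norm (W x ** Z)) \<partial>N) * ennreal (norm u)"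
          using meas by (intro nn_integral_multc) measurable
        also have "\<dots> \<le> ennreal M * ennreal (norm u)"
          using elim unfolding Z_def by (intro mult_right_mono) auto
        finally show ?thesis using M by (simp add: ennreal_mult[symmetric])
      qed
      have VZ: "op_norm (V' ** Z) \<le> real CARD('n) * M"
      proof (rule onorm_le)
        fix u
        have "norm ((V' ** Z) *v u) \<le> (\<Sum>k\<in>UNIV. \<bar>(V' *v (Z *v u)) $ k\<bar>)"
          by (simp add: norm_le_l1_cart matrix_vector_mul_assoc)
        also have "\<dots> \<le> (\<Sum>k\<in>(UNIV::'n set). M * norm u)"
          by (intro sum_mono order_trans[OF V(3) \<rho>Z])
        finally show "norm ((V' ** Z) *v u) \<le> real CARD('n) * M * norm u" by simp
      qed
      show ?case
      proof
        fix x
        have "W x ** Z = W x ** (V ** V') ** Z" by (simp add: V(1))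
        also have "\<dots> = (W x ** V) ** (V' ** Z)" by (simp add: matrix_mul_assoc)
        finally have "op_norm (W x ** Z) \<le> op_norm (W x ** V) * op_norm (V' ** Z)"
          by (simp add: op_norm_mult)
        also have "\<dots> \<le> (\<Sum>j\<in>UNIV. norm (W x *v column j V)) * (real CARD('n) * M)"
        proof (rule mult_mono[OF _ VZ _ op_norm_nonneg])
          show "op_norm (W x ** V) \<le> (\<Sum>j\<in>UNIV. norm (W x *v column j V))"
            unfolding column_mult[symmetric] by (rule onorm_le) (rule norm_matrix_vector_le_columns)
        qed (simp add: sum_nonneg)
        finally show "ennreal (op_norm (W x ** matrix_inv (W y))) \<le> H x"
          unfolding H_def Z_def by (intro ennreal_leI) (simp add: mult_ac)
      qed
    qed
  qed
qed

text \<open>For \<open>p = 1\<close> the conjugate exponent is infinite and the integral becomes an essential supremum.\<close>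
definition inner_bound :: "real \<Rightarrow> 'a measure \<Rightarrow> ('a \<Rightarrow> ennreal) \<Rightarrow> ennreal \<Rightarrow> bool" where
  "inner_bound p N k H \<longleftrightarrow>
    (if p = 1 then AE y in N. k y \<le> H
     else ennreal_powr (\<integral>\<^sup>+y. ennreal_powr (k y) (conj_exp p) \<partial>N) (p / conj_exp p) \<le> H)"

section \<open>Conjugate exponents and the inner Hoelder step\<close>

lemma conj_exp_gt_1: "1 < p \<Longrightarrow> 1 < conj_exp p"
  by (simp add: conj_exp_def)

lemma inverse_conj_exp: "1 < p \<Longrightarrow> 1 / conj_exp p = 1 - 1 / p"
  by (simp add: conj_exp_def field_simps)

text \<open>Since \<open>c\<^sub>0 + c\<^sub>1 = 1\<close>, subtracting the relation for
  \<open>1 / p\<close> gives the same relation for the conjugate exponents, so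
  \<open>c\<^sub>0 * q / q\<^sub>0\<close> and \<open>c\<^sub>1 * q / q\<^sub>1\<close> are
  admissible Hoelder exponents. The exponents in the conclusion sum to 1 as well, by the relation
  for \<open>p\<close>, which prepares the outer application.\<close>

lemma inner_bound_interpolation_gt_1:
  assumes p: "1 < p\<^sub>0" "1 < p\<^sub>1" "1 < p"
    and [measurable]: "k\<^sub>0 \<in> borel_measurable N" "k\<^sub>1 \<in> borel_measurable N"
    and c: "0 < c\<^sub>0" "0 < c\<^sub>1" "c\<^sub>0 + c\<^sub>1 = 1" and pp: "1 / p = c\<^sub>0 / p\<^sub>0 + c\<^sub>1 / p\<^sub>1"
    and b0: "inner_bound p\<^sub>0 N k\<^sub>0 H\<^sub>0" and b1: "inner_bound p\<^sub>1 N k\<^sub>1 H\<^sub>1"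
    and h: "AE y in N. h y \<le> ennreal_powr (k\<^sub>0 y) c\<^sub>0 * ennreal_powr (k\<^sub>1 y) c\<^sub>1"
  shows "inner_bound p N h (ennreal_powr H\<^sub>0 (c\<^sub>0 * p / p\<^sub>0) * ennreal_powr H\<^sub>1 (c\<^sub>1 * p / p\<^sub>1))"
proof -
  define q q\<^sub>0 q\<^sub>1 where "q = conj_exp p" and "q\<^sub>0 = conj_exp p\<^sub>0" and "q\<^sub>1 = conj_exp p\<^sub>1"
  have q: "1 < q" "1 < q\<^sub>0" "1 < q\<^sub>1" unfolding q_def q\<^sub>0_def q\<^sub>1_def by (intro conj_exp_gt_1 p)+
  define I\<^sub>0 I\<^sub>1 where "I\<^sub>0 = (\<integral>\<^sup>+y. ennreal_powr (k\<^sub>0 y) q\<^sub>0 \<partial>N)" and "I\<^sub>1 = (\<integral>\<^sup>+y. ennreal_powr (k\<^sub>1 y) q\<^sub>1 \<partial>N)"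
  define a b where "a = c\<^sub>0 * q / q\<^sub>0" and "b = c\<^sub>1 * q / q\<^sub>1"
  have "a + b = q * (c\<^sub>0 * (1 / q\<^sub>0) + c\<^sub>1 * (1 / q\<^sub>1))"
    by (simp add: a_def b_def algebra_simps)
  also have "c\<^sub>0 * (1 / q\<^sub>0) + c\<^sub>1 * (1 / q\<^sub>1) = (c\<^sub>0 + c\<^sub>1) - (c\<^sub>0 / p\<^sub>0 + c\<^sub>1 / p\<^sub>1)"
    unfolding q\<^sub>0_def q\<^sub>1_def inverse_conj_exp[OF p(1)] inverse_conj_exp[OF p(2)] by (simp add: algebra_simps)
  also have "\<dots> = 1 / q" unfolding q_def inverse_conj_exp[OF p(3)] c(3) pp ..
  finally have ab: "a + b = 1" "0 < a" "0 < b" using q c by (simp_all add: a_def b_def)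
  have "(\<integral>\<^sup>+y. ennreal_powr (h y) q \<partial>N)
      \<le> (\<integral>\<^sup>+y. ennreal_powr (ennreal_powr (k\<^sub>0 y) q\<^sub>0) a * ennreal_powr (ennreal_powr (k\<^sub>1 y) q\<^sub>1) b \<partial>N)"
  proof (rule nn_integral_mono_AE)
    show "AE y in N. ennreal_powr (h y) q
        \<le> ennreal_powr (ennreal_powr (k\<^sub>0 y) q\<^sub>0) a * ennreal_powr (ennreal_powr (k\<^sub>1 y) q\<^sub>1) b"
      using h
    proof eventually_elim
      case (elim y)
      then have "ennreal_powr (h y) q \<le> ennreal_powr (ennreal_powr (k\<^sub>0 y) c\<^sub>0 * ennreal_powr (k\<^sub>1 y) c\<^sub>1) q"
        using q by (intro ennreal_powr_mono) simp_all
      moreover have "q\<^sub>0 * a = c\<^sub>0 * q" "q\<^sub>1 * b = c\<^sub>1 * q" using q by (simp_all add: a_def b_def)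
      ultimately show ?case using q by (simp add: ennreal_powr_mult ennreal_powr_powr)
    qed
  qed
  also have "\<dots> \<le> ennreal_powr I\<^sub>0 a * ennreal_powr I\<^sub>1 b"
    unfolding I\<^sub>0_def I\<^sub>1_def by (intro nn_integral_Hoelder ab) measurable
  finally have "ennreal_powr (\<integral>\<^sup>+y. ennreal_powr (h y) q \<partial>N) (p / q)
      \<le> ennreal_powr (ennreal_powr I\<^sub>0 a * ennreal_powr I\<^sub>1 b) (p / q)"
    using p q by (intro ennreal_powr_mono) simp_all
  also have "\<dots> = ennreal_powr (ennreal_powr I\<^sub>0 (p\<^sub>0 / q\<^sub>0)) (c\<^sub>0 * p / p\<^sub>0) * ennreal_powr (ennreal_powr I\<^sub>1 (p\<^sub>1 / q\<^sub>1)) (c\<^sub>1 * p / p\<^sub>1)"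
    using p q by (simp add: ennreal_powr_mult ennreal_powr_powr a_def b_def field_simps)
  also have "\<dots> \<le> ennreal_powr H\<^sub>0 (c\<^sub>0 * p / p\<^sub>0) * ennreal_powr H\<^sub>1 (c\<^sub>1 * p / p\<^sub>1)"
    using b0 b1 p c unfolding inner_bound_def I\<^sub>0_def I\<^sub>1_def q\<^sub>0_def q\<^sub>1_def
    by (intro mult_mono ennreal_powr_mono) simp_all
  finally show ?thesis using p unfolding inner_bound_def q_def by simp
qed

text \<open>Here the first kernel is bounded by \<open>H\<^sub>0\<close> almost everywhere and
  leaves the integral. The reciprocal of its conjugate exponent counts as 0, so the relation reads
  \<open>1 / q = c\<^sub>1 / q\<^sub>1\<close>; the remaining power \<open>c\<^sub>1 * q\<close> of
  the second kernel is then exactly \<open>q\<^sub>1\<close>, without Hoelder's inequality.\<close>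

lemma inner_bound_interpolation_eq_1:
  assumes p: "1 < p\<^sub>1" "1 < p"
    and [measurable]: "k\<^sub>1 \<in> borel_measurable N"
    and c: "0 < c\<^sub>0" "0 < c\<^sub>1" "c\<^sub>0 + c\<^sub>1 = 1" and pp: "1 / p = c\<^sub>0 + c\<^sub>1 / p\<^sub>1"
    and b0: "inner_bound 1 N k\<^sub>0 H\<^sub>0" and b1: "inner_bound p\<^sub>1 N k\<^sub>1 H\<^sub>1"
    and h: "AE y in N. h y \<le> ennreal_powr (k\<^sub>0 y) c\<^sub>0 * ennreal_powr (k\<^sub>1 y) c\<^sub>1"
  shows "inner_bound p N h (ennreal_powr H\<^sub>0 (c\<^sub>0 * p) * ennreal_powr H\<^sub>1 (c\<^sub>1 * p / p\<^sub>1))"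
proof -
  define q q\<^sub>1 where "q = conj_exp p" and "q\<^sub>1 = conj_exp p\<^sub>1"
  have q: "1 < q" "1 < q\<^sub>1" unfolding q_def q\<^sub>1_def by (intro conj_exp_gt_1 p)+
  have "c\<^sub>1 * (1 / q\<^sub>1) = (c\<^sub>0 + c\<^sub>1) - (c\<^sub>0 + c\<^sub>1 / p\<^sub>1)"
    unfolding q\<^sub>1_def inverse_conj_exp[OF p(1)] by (simp add: algebra_simps)
  also have "\<dots> = 1 / q" unfolding q_def inverse_conj_exp[OF p(2)] c(3) pp ..
  finally have q\<^sub>1: "c\<^sub>1 * q = q\<^sub>1" using q by (simp add: field_simps)
  define I where "I = (\<integral>\<^sup>+y. ennreal_powr (k\<^sub>1 y) q\<^sub>1 \<partial>N)"
  have "AE y in N. k\<^sub>0 y \<le> H\<^sub>0" using b0 by (simp add: inner_bound_def)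
  with h have "AE y in N. ennreal_powr (h y) q \<le> ennreal_powr H\<^sub>0 (c\<^sub>0 * q) * ennreal_powr (k\<^sub>1 y) q\<^sub>1"
  proof eventually_elim
    case (elim y)
    note elim(1)
    also have "ennreal_powr (k\<^sub>0 y) c\<^sub>0 * ennreal_powr (k\<^sub>1 y) c\<^sub>1 \<le> ennreal_powr H\<^sub>0 c\<^sub>0 * ennreal_powr (k\<^sub>1 y) c\<^sub>1"
      using elim(2) c by (intro mult_right_mono ennreal_powr_mono) simp_all
    finally have "ennreal_powr (h y) q \<le> ennreal_powr (ennreal_powr H\<^sub>0 c\<^sub>0 * ennreal_powr (k\<^sub>1 y) c\<^sub>1) q"
      using q by (intro ennreal_powr_mono) simp_all
    then show ?case using q by (simp add: ennreal_powr_mult ennreal_powr_powr q\<^sub>1)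
  qed
  then have "(\<integral>\<^sup>+y. ennreal_powr (h y) q \<partial>N) \<le> (\<integral>\<^sup>+y. ennreal_powr H\<^sub>0 (c\<^sub>0 * q) * ennreal_powr (k\<^sub>1 y) q\<^sub>1 \<partial>N)"
    by (rule nn_integral_mono_AE)
  also have "\<dots> = ennreal_powr H\<^sub>0 (c\<^sub>0 * q) * I"
    unfolding I_def by (rule nn_integral_cmult) measurable
  finally have "ennreal_powr (\<integral>\<^sup>+y. ennreal_powr (h y) q \<partial>N) (p / q)
      \<le> ennreal_powr (ennreal_powr H\<^sub>0 (c\<^sub>0 * q) * I) (p / q)"
    using p q by (intro ennreal_powr_mono) simp_all
  also have "\<dots> = ennreal_powr H\<^sub>0 (c\<^sub>0 * p) * ennreal_powr I (p / q)"
    using p q by (simp add: ennreal_powr_mult ennreal_powr_powr)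
  also have "ennreal_powr I (p / q) = ennreal_powr (ennreal_powr I (p\<^sub>1 / q\<^sub>1)) (c\<^sub>1 * p / p\<^sub>1)"
    using p q c unfolding ennreal_powr_powr q\<^sub>1[symmetric] by simp
  also have "ennreal_powr H\<^sub>0 (c\<^sub>0 * p) * \<dots> \<le> ennreal_powr H\<^sub>0 (c\<^sub>0 * p) * ennreal_powr H\<^sub>1 (c\<^sub>1 * p / p\<^sub>1)"
    using b1 p c unfolding inner_bound_def I_def q\<^sub>1_def
    by (intro mult_left_mono ennreal_powr_mono) simp_all
  finally show ?thesis using p unfolding inner_bound_def q_def by simp
qed

lemma inner_bound_interpolation:
  assumes p: "1 \<le> p\<^sub>0" "1 \<le> p\<^sub>1" "1 < p"
    and k: "k\<^sub>0 \<in> borel_measurable N" "k\<^sub>1 \<in> borel_measurable N"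
    and c: "0 < c\<^sub>0" "0 < c\<^sub>1" "c\<^sub>0 + c\<^sub>1 = 1" and pp: "1 / p = c\<^sub>0 / p\<^sub>0 + c\<^sub>1 / p\<^sub>1"
    and b0: "inner_bound p\<^sub>0 N k\<^sub>0 H\<^sub>0" and b1: "inner_bound p\<^sub>1 N k\<^sub>1 H\<^sub>1"
    and h: "AE y in N. h y \<le> ennreal_powr (k\<^sub>0 y) c\<^sub>0 * ennreal_powr (k\<^sub>1 y) c\<^sub>1"
  shows "inner_bound p N h (ennreal_powr H\<^sub>0 (c\<^sub>0 * p / p\<^sub>0) * ennreal_powr H\<^sub>1 (c\<^sub>1 * p / p\<^sub>1))"
proof -
  consider "p\<^sub>0 = 1" "p\<^sub>1 = 1" | "p\<^sub>0 = 1" "1 < p\<^sub>1" | "1 < p\<^sub>0" "p\<^sub>1 = 1" | "1 < p\<^sub>0" "1 < p\<^sub>1"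
    using p(1,2) by linarith
  then show ?thesis
  proof cases
    case 1
    \<comment> \<open>Two endpoint exponents equal to 1 would force \<open>p = 1\<close>, against
      the assumption.\<close>
    then have "1 / p = 1" using pp c by simp
    then show ?thesis using p(3) by simp
  next
    case 2
    then show ?thesis
      using inner_bound_interpolation_eq_1[OF 2(2) p(3) k(2) c, of k\<^sub>0 H\<^sub>0 H\<^sub>1 h] pp b0 b1 h by simp
  next
    case 3
    have "AE y in N. h y \<le> ennreal_powr (k\<^sub>1 y) c\<^sub>1 * ennreal_powr (k\<^sub>0 y) c\<^sub>0"
      using h by (simp add: mult.commute)
    then show ?thesis
      using inner_bound_interpolation_eq_1[OF 3(1) p(3) k(1) c(2,1), of k\<^sub>1 H\<^sub>1 H\<^sub>0 h] pp b0 b1 3 c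
      by (simp add: add.commute mult.commute)
  next
    case 4
    show ?thesis by (rule inner_bound_interpolation_gt_1[OF 4 p(3) k c pp b0 b1 h])
  qed
qed

section \<open>Matrix weights\<close>

abbreviation weight_kernel :: "('a \<Rightarrow> real^'d^'d) \<Rightarrow> 'a \<Rightarrow> 'a \<Rightarrow> ennreal" where
  "weight_kernel W x y \<equiv> ennreal (op_norm (W x ** matrix_inv (W y)))"

lemma borel_measurable_unif: "borel_measurable (unif Q) = borel_measurable lebesgue"
  by (rule measurable_cong_sets) simp_all

lemma matrix_weightD:
  assumes "matrix_weight W"
  shows "mat_measurable lebesgue W" "AE x in lebesgue. positive_definite (W x)"
    "mat_measurable lebesgue (\<lambda>x. matrix_inv (W x))" "transpose (W x) = W x"
  using assms mat_measurable_inv[of W]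
  by (auto simp: matrix_weight_def mat_measurable_def[symmetric] psd_mats_def)

text \<open>In the joint statement the second factor carries the normalised measure of the cube, so
  that for a cube, where it is a probability measure, integrating over it leaves a measurable
  function of the first variable.\<close>

lemma weight_kernel_measurable:
  fixes W :: "real^'n \<Rightarrow> real^'d^'d"
  assumes "matrix_weight W"
  shows "weight_kernel W x \<in> borel_measurable lebesgue"
    "(\<lambda>x. weight_kernel W x y) \<in> borel_measurable lebesgue"
    "(\<lambda>(x, y). weight_kernel W x y) \<in> borel_measurable (lebesgue \<Otimes>\<^sub>M unif Q)"
proof -
  have "mat_measurable lebesgue (\<lambda>y. W x ** matrix_inv (W y))" for x
    by (intro mat_measurable_mult[OF mat_measurable_const] matrix_weightD assms)
  then show "weight_kernel W x \<in> borel_measurable lebesgue"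
    by (intro measurable_compose[OF _ measurable_ennreal] op_norm_measurable)
  have "mat_measurable lebesgue (\<lambda>x. W x ** matrix_inv (W y))" for y
    by (intro mat_measurable_mult[OF _ mat_measurable_const] matrix_weightD assms)
  then show "(\<lambda>x. weight_kernel W x y) \<in> borel_measurable lebesgue"
    by (intro measurable_compose[OF _ measurable_ennreal] op_norm_measurable)
  have "mat_measurable (lebesgue \<Otimes>\<^sub>M unif Q) (\<lambda>z. W (fst z))"
    by (rule mat_measurable_compose[OF matrix_weightD(1)[OF assms]]) simp
  moreover have "snd \<in> measurable (lebesgue \<Otimes>\<^sub>M unif Q) (lebesgue :: (real^'n) measure)"
    using measurable_snd[of "lebesgue" "unif Q"] by (simp add: measurable_cong_sets[OF refl sets_uniform_measure])
  then have "mat_measurable (lebesgue \<Otimes>\<^sub>M unif Q) (\<lambda>z. matrix_inv (W (snd z)))"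
    by (rule mat_measurable_compose[OF matrix_weightD(3)[OF assms]])
  ultimately have "mat_measurable (lebesgue \<Otimes>\<^sub>M unif Q) (\<lambda>z. W (fst z) ** matrix_inv (W (snd z)))"
    by (rule mat_measurable_mult)
  then show "(\<lambda>(x, y). weight_kernel W x y) \<in> borel_measurable (lebesgue \<Otimes>\<^sub>M unif Q)"
    unfolding case_prod_unfold by (intro measurable_compose[OF _ measurable_ennreal] op_norm_measurable)
qed

text \<open>The integrand of the outer average in \<open>Ap_const\<close>. For
  \<open>p \<noteq> 1\<close> it is the least \<open>H\<close> that satisfies
  \<open>inner_bound\<close> for the kernel at \<open>x\<close>.\<close>

definition inner_average :: "real \<Rightarrow> (real^'n \<Rightarrow> real^'d^'d) \<Rightarrow> (real^'n) set \<Rightarrow> real^'n \<Rightarrow> ennreal" where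
  "inner_average p W Q x =
    ennreal_powr (\<integral>\<^sup>+y. ennreal_powr (weight_kernel W x y) (conj_exp p) \<partial>unif Q) (p / conj_exp p)"

lemma inner_average_measurable:
  assumes "matrix_weight W" "Q \<in> cubes"
  shows "inner_average p W Q \<in> borel_measurable lebesgue"
proof -
  interpret prob_space "unif Q" by (rule prob_space_unif[OF assms(2)])
  have "(\<lambda>(x, y). ennreal_powr (weight_kernel W x y) (conj_exp p)) \<in> borel_measurable (lebesgue \<Otimes>\<^sub>M unif Q)"
    using borel_measurable_ennreal_powr[OF weight_kernel_measurable(3)[OF assms(1)], of "conj_exp p"]
    by (simp add: case_prod_unfold)
  from borel_measurable_ennreal_powr[OF borel_measurable_nn_integral[OF this]]
  show ?thesis unfolding inner_average_def .
qed

lemma Ap_const_eq: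
  fixes W :: "real^'n \<Rightarrow> real^'d^'d"
  assumes W: "matrix_weight W"
  shows "Ap_const p W = (SUP Q\<in>cubes. ennreal_powr (\<integral>\<^sup>+x. inner_average p W Q x \<partial>unif Q) (1 / p))"
  unfolding Ap_const_def
proof (rule SUP_cong[OF refl])
  fix Q :: "(real^'n) set" assume Q: "Q \<in> cubes"
  have "(\<lambda>y. ennreal (op_norm (W x ** matrix_inv (W y)) powr conj_exp p))
      = (\<lambda>y. ennreal_powr (weight_kernel W x y) (conj_exp p))" for x
    by (simp add: ennreal_powr_ennreal op_norm_nonneg)
  moreover have "average Q (\<lambda>y. ennreal_powr (weight_kernel W x y) (conj_exp p))
      = (\<integral>\<^sup>+y. ennreal_powr (weight_kernel W x y) (conj_exp p) \<partial>unif Q)" for x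
    by (intro average_eq_nn_integral[OF Q] borel_measurable_ennreal_powr weight_kernel_measurable W)
  ultimately have "ennreal_powr (average Q (\<lambda>y. ennreal (op_norm (W x ** matrix_inv (W y)) powr conj_exp p))) (p / conj_exp p)
      = inner_average p W Q x" for x
    by (simp add: inner_average_def)
  then show "ennreal_powr (average Q (\<lambda>x. ennreal_powr (average Q (\<lambda>y. ennreal (op_norm (W x ** matrix_inv (W y)) powr conj_exp p)))
        (p / conj_exp p))) (1 / p) = ennreal_powr (\<integral>\<^sup>+x. inner_average p W Q x \<partial>unif Q) (1 / p)"
    by (simp add: average_eq_nn_integral[OF Q inner_average_measurable[OF W Q]])
qed

text \<open>\<open>A1_const\<close> has the inverse on the left, \<open>Ap_const\<close> on the
  right. Transposition identifies the two norms, so a single kernel serves both conditions; in the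
  A_1 condition its first variable is averaged and its second one is subject to the essential
  supremum.\<close>

lemma op_norm_inv_mult_commute:
  assumes "positive_definite A" "transpose B = B"
  shows "op_norm (matrix_inv A ** B) = op_norm (B ** matrix_inv A)"
  using op_norm_transpose[of "matrix_inv A ** B"] positive_definite_inv(3)[OF assms(1)] assms(2)
  by (simp add: matrix_transpose_mul)

lemma A1_kernel_average:
  assumes W: "matrix_weight W" and Q: "Q \<in> cubes"
  shows "AE y in unif Q. (\<integral>\<^sup>+x. weight_kernel W x y \<partial>unif Q) = average Q (\<lambda>x. ennreal (op_norm (matrix_inv (W y) ** W x)))"
proof -
  have "AE y in unif Q. positive_definite (W y)"
    by (rule AE_unifI[OF Q matrix_weightD(2)[OF W]])
  then show ?thesis
  proof eventually_elim
    case (elim y)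
    show ?case
      unfolding op_norm_inv_mult_commute[OF elim matrix_weightD(4)[OF W]]
      by (rule average_eq_nn_integral[OF Q weight_kernel_measurable(2)[OF W], symmetric])
  qed
qed

lemma AE_restrict_cube_iff:
  assumes "Q \<in> cubes"
  shows "(AE x in restrict_space lebesgue Q. P x) \<longleftrightarrow> (AE x in unif Q. P x)"
  using cube_emeasure(1)[OF assms] by (simp add: AE_restrict_space_iff AE_unif_iff[OF assms])

lemma A1_const_AE:
  assumes W: "matrix_weight W" and Q: "Q \<in> cubes"
  shows "AE y in unif Q. (\<integral>\<^sup>+x. weight_kernel W x y \<partial>unif Q) \<le> A1_const W"
proof -
  define f where "f y = average Q (\<lambda>x. ennreal (op_norm (matrix_inv (W y) ** W x)))" for y
  have "esssup (restrict_space lebesgue Q) f \<le> A1_const W"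
    unfolding A1_const_def f_def using Q by (rule SUP_upper)
  moreover have "AE y in unif Q. f y \<le> esssup (restrict_space lebesgue Q) f"
    using esssup_AE unfolding AE_restrict_cube_iff[OF Q, symmetric] .
  ultimately have "AE y in unif Q. f y \<le> A1_const W" by (auto elim: eventually_mono order_trans)
  with A1_kernel_average[OF W Q] show ?thesis
    by eventually_elim (simp add: f_def)
qed

text \<open>An upper bound for an essential supremum requires the function to be measurable, which
  accounts for most of the proof: the average is measurable in \<open>y\<close> because the kernel
  is jointly measurable.\<close>

lemma A1_const_le:
  fixes W :: "real^'n \<Rightarrow> real^'d^'d"
  assumes W: "matrix_weight W"
    and le: "\<And>Q. Q \<in> cubes \<Longrightarrow> AE y in unif Q. (\<integral>\<^sup>+x. weight_kernel W x y \<partial>unif Q) \<le> C"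
  shows "A1_const W \<le> C"
  unfolding A1_const_def
proof (rule SUP_least)
  fix Q :: "(real^'n) set" assume Q: "Q \<in> cubes"
  interpret prob_space "unif Q" by (rule prob_space_unif[OF Q])
  have "mat_measurable (lebesgue \<Otimes>\<^sub>M unif Q) (\<lambda>z. matrix_inv (W (fst z)))"
    by (rule mat_measurable_compose[OF matrix_weightD(3)[OF W]]) simp
  moreover have "snd \<in> measurable (lebesgue \<Otimes>\<^sub>M unif Q) (lebesgue :: (real^'n) measure)"
    using measurable_snd[of "lebesgue" "unif Q"] by (simp add: measurable_cong_sets[OF refl sets_uniform_measure])
  then have "mat_measurable (lebesgue \<Otimes>\<^sub>M unif Q) (\<lambda>z. W (snd z))"
    by (rule mat_measurable_compose[OF matrix_weightD(1)[OF W]])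
  ultimately have "mat_measurable (lebesgue \<Otimes>\<^sub>M unif Q) (\<lambda>z. matrix_inv (W (fst z)) ** W (snd z))"
    by (rule mat_measurable_mult)
  then have "(\<lambda>(y, x). ennreal (op_norm (matrix_inv (W y) ** W x))) \<in> borel_measurable (lebesgue \<Otimes>\<^sub>M unif Q)"
    unfolding case_prod_unfold by (intro measurable_compose[OF _ measurable_ennreal] op_norm_measurable)
  from borel_measurable_nn_integral[OF this]
  have "(\<lambda>y. \<integral>\<^sup>+x. ennreal (op_norm (matrix_inv (W y) ** W x)) \<partial>unif Q) \<in> borel_measurable lebesgue" .
  moreover have "average Q (\<lambda>x. ennreal (op_norm (matrix_inv (W y) ** W x)))
      = (\<integral>\<^sup>+x. ennreal (op_norm (matrix_inv (W y) ** W x)) \<partial>unif Q)" for y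
    by (intro average_eq_nn_integral[OF Q] measurable_compose[OF _ measurable_ennreal] op_norm_measurable
        mat_measurable_mult[OF mat_measurable_const] matrix_weightD W)
  ultimately have "(\<lambda>y. average Q (\<lambda>x. ennreal (op_norm (matrix_inv (W y) ** W x)))) \<in> borel_measurable (restrict_space lebesgue Q)"
    by (simp add: measurable_restrict_space1)
  moreover have "AE y in unif Q. average Q (\<lambda>x. ennreal (op_norm (matrix_inv (W y) ** W x))) \<le> C"
    using A1_kernel_average[OF W Q] le[OF Q] by eventually_elim simp
  ultimately show "esssup (restrict_space lebesgue Q)
      (\<lambda>y. average Q (\<lambda>x. ennreal (op_norm (matrix_inv (W y) ** W x)))) \<le> C"
    unfolding AE_restrict_cube_iff[OF Q, symmetric] by (rule esssup_I)
qed

lemma bounded_weight_norm_le: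
  fixes W :: "'a \<Rightarrow> real^'d^'d"
  assumes "bounded (range (\<lambda>x. SUP v\<in>{v. norm v = 1}. norm (W x *v v)))"
  shows "\<exists>K. \<forall>x v. norm (W x *v v) \<le> K * norm v"
proof -
  obtain K where K: "\<And>x. \<bar>SUP v\<in>{v. norm v = 1}. norm (W x *v v)\<bar> \<le> K"
    using assms unfolding bounded_iff by auto
  have "norm (W x *v v) \<le> K * norm v" for x v
  proof (cases "v = 0")
    case False
    \<comment> \<open>A supremum of reals dominates the members of the set only once the set is
      known to be bounded above; the operator norm at the fixed \<open>x\<close> provides
      that.\<close>
    have "bdd_above ((\<lambda>v. norm (W x *v v)) ` {v. norm v = 1})"
    proof (rule bdd_aboveI2)
      fix u :: "real^'d" assume "u \<in> {v. norm v = 1}"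
      then show "norm (W x *v u) \<le> op_norm (W x)" using op_norm_bound[of "W x" u] by simp
    qed
    then have "norm (W x *v (v /\<^sub>R norm v)) \<le> (SUP v\<in>{v. norm v = 1}. norm (W x *v v))"
      using False by (intro cSUP_upper) simp_all
    also have "\<dots> \<le> K" using K[of x] by simp
    finally have "norm (W x *v v) / norm v \<le> K"
      by (simp add: matrix_vector_mult_scaleR divide_inverse mult.commute)
    then show ?thesis using False by (simp add: pos_divide_le_eq)
  qed simp
  then show ?thesis by blast
qed

text \<open>The common form in which both conditions enter the interpolation, with one constant for
  all cubes. For \<open>p \<noteq> 1\<close> the majorant \<open>H\<close> is the inner average
  itself; for \<open>p = 1\<close> it comes from the separated bound.\<close>

lemma A_matrix_inner_bound:
  fixes W :: "real^'n \<Rightarrow> real^'d^'d"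
  assumes p: "1 \<le> p" and A: "W \<in> A_matrix p" and bound: "\<And>x v. norm (W x *v v) \<le> K * norm v"
  shows "\<exists>C<\<infinity>. \<forall>Q\<in>cubes. \<exists>H\<in>borel_measurable lebesgue.
    (\<integral>\<^sup>+x. H x \<partial>unif Q) \<le> C \<and> (\<forall>x. inner_bound p (unif Q) (weight_kernel W x) (H x))"
proof (cases "p = 1")
  case True
  have W: "matrix_weight W" and fin: "A1_const W < \<infinity>" using A True by (auto simp: A_matrix_def)
  define M where "M = enn2real (A1_const W)"
  have M: "0 \<le> M" "A1_const W = ennreal M" using fin by (simp_all add: M_def)
  show ?thesis
  proof (intro exI[of _ "ennreal (real CARD('d) * real CARD('d) * M)"] conjI ballI)
    fix Q :: "(real^'n) set" assume Q: "Q \<in> cubes"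
    have meas: "mat_measurable (unif Q) W"
      using matrix_weightD(1)[OF W] by (simp add: mat_measurable_def borel_measurable_unif)
    obtain H where H: "H \<in> borel_measurable (unif Q)" "(\<integral>\<^sup>+x. H x \<partial>unif Q) \<le> ennreal (real CARD('d) * real CARD('d) * M)"
      "AE y in unif Q. \<forall>x. weight_kernel W x y \<le> H x"
      by (rule A1_imp_separated_bound[OF prob_space_unif[OF Q] meas AE_unifI[OF Q matrix_weightD(2)[OF W]] bound M(1)
            A1_const_AE[OF W Q, unfolded M(2)]])
    have "inner_bound p (unif Q) (weight_kernel W x) (H x)" for x
      unfolding inner_bound_def using True H(3) by (auto elim: eventually_mono)
    with H show "\<exists>H\<in>borel_measurable lebesgue. (\<integral>\<^sup>+x. H x \<partial>unif Q) \<le> ennreal (real CARD('d) * real CARD('d) * M)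
        \<and> (\<forall>x. inner_bound p (unif Q) (weight_kernel W x) (H x))"
      by (auto simp: borel_measurable_unif)
  qed simp
next
  case False
  have W: "matrix_weight W" and fin: "Ap_const p W < \<infinity>" using A False by (auto simp: A_matrix_def)
  show ?thesis
  proof (intro exI[of _ "ennreal_powr (Ap_const p W) p"] conjI ballI)
    show "ennreal_powr (Ap_const p W) p < \<infinity>" using fin by (simp only: ennreal_powr_less_top)
    fix Q :: "(real^'n) set" assume Q: "Q \<in> cubes"
    have "ennreal_powr (\<integral>\<^sup>+x. inner_average p W Q x \<partial>unif Q) (1 / p) \<le> Ap_const p W"
      unfolding Ap_const_eq[OF W] using Q by (rule SUP_upper)
    then have "ennreal_powr (ennreal_powr (\<integral>\<^sup>+x. inner_average p W Q x \<partial>unif Q) (1 / p)) p \<le> ennreal_powr (Ap_const p W) p"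
      using p by (intro ennreal_powr_mono) simp_all
    then have "(\<integral>\<^sup>+x. inner_average p W Q x \<partial>unif Q) \<le> ennreal_powr (Ap_const p W) p"
      using p by (simp add: ennreal_powr_powr)
    moreover have "inner_bound p (unif Q) (weight_kernel W x) (inner_average p W Q x)" for x
      unfolding inner_bound_def inner_average_def using False by simp
    ultimately show "\<exists>H\<in>borel_measurable lebesgue. (\<integral>\<^sup>+x. H x \<partial>unif Q) \<le> ennreal_powr (Ap_const p W) p
        \<and> (\<forall>x. inner_bound p (unif Q) (weight_kernel W x) (H x))"
      using inner_average_measurable[OF W Q] by blast
  qed
qed

theorem theorem4p2:
  fixes W\<^sub>0 W\<^sub>1 :: "real^'n \<Rightarrow> real^'d^'d" and p\<^sub>0 p\<^sub>1 p t :: real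
  assumes "1 \<le> p\<^sub>0" and "1 \<le> p\<^sub>1"
    and "matrix_weight W\<^sub>0" and "matrix_weight W\<^sub>1"
    and "W\<^sub>0 \<in> A_matrix p\<^sub>0" and "W\<^sub>1 \<in> A_matrix p\<^sub>1"
    and "bounded (range (\<lambda>x. SUP v\<in>{v. norm v = 1}. norm (W\<^sub>0 x *v v)))"
    and "bounded (range (\<lambda>x. SUP v\<in>{v. norm v = 1}. norm (W\<^sub>1 x *v v)))"
    and "0 < t" and "t < 1"
    and "1 / p = (1 - t) / p\<^sub>0 + t / p\<^sub>1"
  shows "(\<lambda>x. mat_powr (geo_mean t (W\<^sub>0 x ** W\<^sub>0 x) (W\<^sub>1 x ** W\<^sub>1 x)) (1/2)) \<in> A_matrix p"
proof -
  define G where "G x = mat_powr (geo_mean t (W\<^sub>0 x ** W\<^sub>0 x) (W\<^sub>1 x ** W\<^sub>1 x)) (1/2)" for x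
  have G: "matrix_weight G"
    unfolding G_def by (rule matrix_weight_sqrt_geo_mean[OF assms(3,4)])
  have t: "0 < 1 - t" "0 < t" "1 - t + t = 1" using assms(9,10) by simp_all
  have kernel: "weight_kernel G x y \<le> ennreal_powr (weight_kernel W\<^sub>0 x y) (1 - t) * ennreal_powr (weight_kernel W\<^sub>1 x y) t"
    if "positive_definite (W\<^sub>0 x)" "positive_definite (W\<^sub>1 x)" "positive_definite (W\<^sub>0 y)" "positive_definite (W\<^sub>1 y)" for x y
    using op_norm_sqrt_geo_mean_le[OF that, of t] t
    by (simp add: G_def ennreal_powr_ennreal op_norm_nonneg ennreal_mult[symmetric] ennreal_leI)
  have pd: "AE x in unif Q. positive_definite (W\<^sub>0 x)" "AE x in unif Q. positive_definite (W\<^sub>1 x)"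
    if "Q \<in> cubes" for Q
    by (intro AE_unifI[OF that] matrix_weightD(2) assms(3,4))+
  have k_meas: "weight_kernel W\<^sub>0 x \<in> borel_measurable (unif Q)" "weight_kernel W\<^sub>1 x \<in> borel_measurable (unif Q)"
    "(\<lambda>x. weight_kernel W\<^sub>0 x y) \<in> borel_measurable (unif Q)" "(\<lambda>x. weight_kernel W\<^sub>1 x y) \<in> borel_measurable (unif Q)" for x y Q
    unfolding borel_measurable_unif by (intro weight_kernel_measurable assms(3,4))+
  have pp: "1 / p\<^sub>0 \<le> 1" "1 / p\<^sub>1 \<le> 1" using assms(1,2) by simp_all
  \<comment> \<open>Nothing is assumed about the sign of \<open>p\<close>; positivity of
    \<open>1 / p\<close> excludes \<open>p \<le> 0\<close>, including \<open>p = 0\<close>, where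
    \<open>1 / p\<close> is 0.\<close>
  have p_pos: "0 < 1 / p" unfolding assms(11) using t assms(1,2) by (intro add_pos_pos divide_pos_pos) auto
  have p_le: "1 / p \<le> 1"
    using add_mono[OF mult_left_mono[OF pp(1), of "1 - t"] mult_left_mono[OF pp(2), of t]] t
    unfolding assms(11) by simp
  have p1: "1 \<le> p" using p_pos p_le by (simp add: field_simps)
  have "(if p = 1 then A1_const G else Ap_const p G) < \<infinity>"
  proof (cases "p = 1")
    case True
    have "p\<^sub>0 = 1 \<and> p\<^sub>1 = 1"
    proof -
      \<comment> \<open>The left side equals \<open>1 - 1 / p\<close>; both summands are
        nonnegative, so both vanish and each endpoint exponent is 1.\<close>
      have "(1 - t) * (1 - 1 / p\<^sub>0) + t * (1 - 1 / p\<^sub>1) = 0"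
        using assms(11) True by (simp add: algebra_simps)
      moreover have "0 \<le> (1 - t) * (1 - 1 / p\<^sub>0)" "0 \<le> t * (1 - 1 / p\<^sub>1)" using t pp by simp_all
      ultimately have "(1 - t) * (1 - 1 / p\<^sub>0) = 0" "t * (1 - 1 / p\<^sub>1) = 0" by linarith+
      then show ?thesis using t assms(1,2) by auto
    qed
    then have fin: "A1_const W\<^sub>0 < \<infinity>" "A1_const W\<^sub>1 < \<infinity>" using assms(5,6) by (simp_all add: A_matrix_def)
    have "A1_const G \<le> ennreal_powr (A1_const W\<^sub>0) (1 - t) * ennreal_powr (A1_const W\<^sub>1) t"
    proof (rule A1_const_le[OF G])
      fix Q :: "(real^'n) set" assume Q: "Q \<in> cubes"
      show "AE y in unif Q. (\<integral>\<^sup>+x. weight_kernel G x y \<partial>unif Q)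
          \<le> ennreal_powr (A1_const W\<^sub>0) (1 - t) * ennreal_powr (A1_const W\<^sub>1) t"
        using pd[OF Q] A1_const_AE[OF assms(3) Q] A1_const_AE[OF assms(4) Q]
      proof eventually_elim
        case (elim y)
        have "(\<integral>\<^sup>+x. weight_kernel G x y \<partial>unif Q)
            \<le> (\<integral>\<^sup>+x. ennreal_powr (weight_kernel W\<^sub>0 x y) (1 - t) * ennreal_powr (weight_kernel W\<^sub>1 x y) t \<partial>unif Q)"
        proof (rule nn_integral_mono_AE)
          show "AE x in unif Q. weight_kernel G x y
              \<le> ennreal_powr (weight_kernel W\<^sub>0 x y) (1 - t) * ennreal_powr (weight_kernel W\<^sub>1 x y) t"
            using pd[OF Q] by eventually_elim (rule kernel[OF _ _ elim(1,2)])
        qed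
        also have "\<dots> \<le> ennreal_powr (\<integral>\<^sup>+x. weight_kernel W\<^sub>0 x y \<partial>unif Q) (1 - t)
            * ennreal_powr (\<integral>\<^sup>+x. weight_kernel W\<^sub>1 x y \<partial>unif Q) t"
          by (rule nn_integral_Hoelder[OF k_meas(3,4) t])
        also have "\<dots> \<le> ennreal_powr (A1_const W\<^sub>0) (1 - t) * ennreal_powr (A1_const W\<^sub>1) t"
          using elim t by (intro mult_mono ennreal_powr_mono) simp_all
        finally show ?case .
      qed
    qed
    also have "\<dots> < \<infinity>"
      using fin by (simp add: ennreal_mult_less_top ennreal_powr_less_top[unfolded infinity_ennreal_def])
    finally show ?thesis using True by simp
  next
    case False
    then have p: "1 < p" using p1 by simp
    obtain K\<^sub>0 where K0: "\<And>x v. norm (W\<^sub>0 x *v v) \<le> K\<^sub>0 * norm v" 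
      using bounded_weight_norm_le[OF assms(7)] by blast
    obtain K\<^sub>1 where K1: "\<And>x v. norm (W\<^sub>1 x *v v) \<le> K\<^sub>1 * norm v" 
      using bounded_weight_norm_le[OF assms(8)] by blast
    obtain C\<^sub>0 where C0: "C\<^sub>0 < \<infinity>" "\<And>Q. Q \<in> cubes \<Longrightarrow> \<exists>H\<in>borel_measurable lebesgue.
        (\<integral>\<^sup>+x. H x \<partial>unif Q) \<le> C\<^sub>0 \<and> (\<forall>x. inner_bound p\<^sub>0 (unif Q) (weight_kernel W\<^sub>0 x) (H x))"
      using A_matrix_inner_bound[OF assms(1,5) K0] by blast
    obtain C\<^sub>1 where C1: "C\<^sub>1 < \<infinity>" "\<And>Q. Q \<in> cubes \<Longrightarrow> \<exists>H\<in>borel_measurable lebesgue.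
        (\<integral>\<^sup>+x. H x \<partial>unif Q) \<le> C\<^sub>1 \<and> (\<forall>x. inner_bound p\<^sub>1 (unif Q) (weight_kernel W\<^sub>1 x) (H x))"
      using A_matrix_inner_bound[OF assms(2,6) K1] by blast
    \<comment> \<open>Exponents of the outer Hoelder step; that they sum to 1 is the defining
      relation of \<open>p\<close> multiplied by \<open>p\<close>.\<close>
    define a b where "a = (1 - t) * p / p\<^sub>0" and "b = t * p / p\<^sub>1"
    have "a + b = p * (1 / p)" unfolding assms(11) by (simp add: a_def b_def algebra_simps)
    then have ab: "0 < a" "0 < b" "a + b = 1"
      using t p assms(1,2) by (simp_all add: a_def b_def)
    have "Ap_const p G \<le> ennreal_powr (ennreal_powr C\<^sub>0 a * ennreal_powr C\<^sub>1 b) (1 / p)"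
      unfolding Ap_const_eq[OF G]
    proof (intro SUP_least ennreal_powr_mono)
      fix Q :: "(real^'n) set" assume Q: "Q \<in> cubes"
      obtain H\<^sub>0 where H0: "H\<^sub>0 \<in> borel_measurable (unif Q)" "(\<integral>\<^sup>+x. H\<^sub>0 x \<partial>unif Q) \<le> C\<^sub>0"
        "\<And>x. inner_bound p\<^sub>0 (unif Q) (weight_kernel W\<^sub>0 x) (H\<^sub>0 x)"
        using C0(2)[OF Q] by (auto simp: borel_measurable_unif)
      obtain H\<^sub>1 where H1: "H\<^sub>1 \<in> borel_measurable (unif Q)" "(\<integral>\<^sup>+x. H\<^sub>1 x \<partial>unif Q) \<le> C\<^sub>1"
        "\<And>x. inner_bound p\<^sub>1 (unif Q) (weight_kernel W\<^sub>1 x) (H\<^sub>1 x)"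
        using C1(2)[OF Q] by (auto simp: borel_measurable_unif)
      \<comment> \<open>The integration in \<open>y\<close> ends here: the kernel enters the outer
        integral only through the majorants, whether or not an endpoint exponent is 1.\<close>
      have "AE x in unif Q. inner_average p G Q x \<le> ennreal_powr (H\<^sub>0 x) a * ennreal_powr (H\<^sub>1 x) b"
        using pd[OF Q]
      proof eventually_elim
        case (elim x)
        have "AE y in unif Q. weight_kernel G x y
            \<le> ennreal_powr (weight_kernel W\<^sub>0 x y) (1 - t) * ennreal_powr (weight_kernel W\<^sub>1 x y) t"
          using pd[OF Q] by eventually_elim (rule kernel[OF elim])
        from inner_bound_interpolation[OF assms(1,2) p k_meas(1,2) t assms(11) H0(3) H1(3) this]
        show ?case using p by (simp add: inner_bound_def inner_average_def a_def b_def)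
      qed
      then have "(\<integral>\<^sup>+x. inner_average p G Q x \<partial>unif Q)
          \<le> (\<integral>\<^sup>+x. ennreal_powr (H\<^sub>0 x) a * ennreal_powr (H\<^sub>1 x) b \<partial>unif Q)"
        by (rule nn_integral_mono_AE)
      also have "\<dots> \<le> ennreal_powr (\<integral>\<^sup>+x. H\<^sub>0 x \<partial>unif Q) a * ennreal_powr (\<integral>\<^sup>+x. H\<^sub>1 x \<partial>unif Q) b"
        by (rule nn_integral_Hoelder[OF H0(1) H1(1) ab])
      also have "\<dots> \<le> ennreal_powr C\<^sub>0 a * ennreal_powr C\<^sub>1 b"
        using H0(2) H1(2) ab by (intro mult_mono ennreal_powr_mono) simp_all
      finally show "(\<integral>\<^sup>+x. inner_average p G Q x \<partial>unif Q) \<le> ennreal_powr C\<^sub>0 a * ennreal_powr C\<^sub>1 b" .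
    qed (use p in simp)
    also have "\<dots> < \<infinity>"
      using C0(1) C1(1) by (simp add: ennreal_mult_less_top ennreal_powr_less_top[unfolded infinity_ennreal_def])
    finally show ?thesis using False by simp
  qed
  with G show ?thesis unfolding G_def[symmetric] by (simp add: A_matrix_def)
qed

end
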